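(* Let $2\le p<\infty$, $1/p+1/p'=1$, and for a function $k:(0,1]\to\mathbb R$ consider the operator $(T_Kf)(t)=\int_0^1K(t,x)f(x)\,dx$, $t\in[0,1]$, with kernel $K$ given either by (WS) $K(t,x)=k(|t-x|)$, or by (VO) $K(t,x)=k(t-x)$ for $x<t$ and $K(t,x)=0$ for $x\ge t$. (i) If $k(x)=x^{-\tau}$ with $0<\tau<\frac1{p'}$, then $T_K$ maps $L_p[0,1]$ into $C[0,1]$, and in both cases (WS) and (VO) $$e_n(T_K:L_p[0,1]\to C[0,1])\preccurlyeq n^{\tau-1}.$$ (ii) If $k(x)=x^{-1/p'}(c_0-\ln x)^{-\beta}$ with $\frac1{p'}<\beta$ and $c_0>0$, then $T_K$ maps $L_p[0,1]$ into $C[0,1]$, and in both cases (WS) and (VO) $$e_n(T_K:L_p[0,1]\to C[0,1])\preccurlyeq\begin{cases}n^{1/p'-\beta},&1/p'<\beta<1,\\ n^{-1/p}(\log(n+1))^{1-\beta},&1<\beta<\infty,\\ n^{-1/p}\log(n+1),&\beta=1.\end{cases}$$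
   Context: $\log$ is the logarithm to base 2 and $\ln$ the natural logarithm. For positive sequences, $x_n\preccurlyeq y_n$ means that there is a constant $c>0$ with $x_n\le c\,y_n$ for all $n\in\mathbb N$. Entropy numbers: for a bounded subset $A$ of a metric space $M$, $\varepsilon_n(A)=\inf\{\varepsilon\ge0:\exists x_1,\dots,x_n\in M,\ A\subset\bigcup_{i=1}^n B_M(x_i,\varepsilon)\}$ with closed balls, $e_n(A)=\varepsilon_{2^{n-1}}(A)$; for a bounded linear operator $T:X\to Y$ between Banach spaces, $e_n(T)=e_n(T(B_X))$ with $B_X$ the closed unit ball of $X$. *)

theory Defs
  imports "HOL-Analysis.Analysis"
begin

definition dominated_by :: "(nat \<Rightarrow> real) \<Rightarrow> (nat \<Rightarrow> real) \<Rightarrow> bool"  (infix "\<preceq>" 50)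
  where "x \<preceq> y \<longleftrightarrow> (\<exists>c>0. \<forall>n\<ge>1. x n \<le> c * y n)"

(* For n >= 1 and a bounded subset A of the space m, the infimum is taken over a nonempty
   set that is bounded below.  The centres lie in m, not necessarily in A. *)
definition covering_radius :: "'a metric \<Rightarrow> nat \<Rightarrow> 'a set \<Rightarrow> real"
  where "covering_radius m n A =
    Inf {\<epsilon>. 0 \<le> \<epsilon> \<and> (\<exists>x. (\<forall>i\<in>{1..n}. x i \<in> mspace m) \<and> A \<subseteq> (\<Union>i\<in>{1..n}. mcball_of m (x i) \<epsilon>))}"

definition entropy_number :: "'a metric \<Rightarrow> nat \<Rightarrow> 'a set \<Rightarrow> real"
  where "entropy_number m n A = covering_radius m (2 ^ (n - 1)) A"

(* L_p[0,1] is given by its representatives: functions equal almost everywhere stand for the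
   same element, and values outside [0,1] are irrelevant.  Images of the unit ball under
   integral operators do not depend on the choice of representatives. *)
definition Lp :: "real \<Rightarrow> (real \<Rightarrow> real) set"
  where "Lp p = {f. f \<in> borel_measurable (lebesgue_on {0..1}) \<and>
                    integrable (lebesgue_on {0..1}) (\<lambda>x. \<bar>f x\<bar> powr p)}"

definition Lp_norm :: "real \<Rightarrow> (real \<Rightarrow> real) \<Rightarrow> real"
  where "Lp_norm p f = (\<integral>x. \<bar>f x\<bar> powr p \<partial>lebesgue_on {0..1}) powr (1 / p)"

definition Lp_unit_ball :: "real \<Rightarrow> (real \<Rightarrow> real) set"
  where "Lp_unit_ball p = {f \<in> Lp p. Lp_norm p f \<le> 1}"

(* The elements of this space take the value undefined outside [0,1]. *)
definition C01 :: "(real \<Rightarrow> real) metric"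
  where "C01 = cfunspace (top_of_set {0..1}) euclidean_metric"

definition integral_operator :: "(real \<Rightarrow> real \<Rightarrow> real) \<Rightarrow> (real \<Rightarrow> real) \<Rightarrow> real \<Rightarrow> real"
  where "integral_operator K f =
    (\<lambda>t\<in>{0..1}. \<integral>x. K t x * f x \<partial>lebesgue_on {0..1})"

(* The integral of a non-integrable function is 0 by convention, so integrability is required
   explicitly; it also makes the operator linear and well defined on classes of functions. *)
definition bounded_operator_Lp_C01 :: "real \<Rightarrow> (real \<Rightarrow> real \<Rightarrow> real) \<Rightarrow> bool"
  where "bounded_operator_Lp_C01 p K \<longleftrightarrow>
    (\<forall>f\<in>Lp p. (\<forall>t\<in>{0..1}. integrable (lebesgue_on {0..1}) (\<lambda>x. K t x * f x)) \<and>
              integral_operator K f \<in> mspace C01) \<and>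
    (\<exists>B. \<forall>f\<in>Lp p. mdist C01 (integral_operator K f) (\<lambda>t\<in>{0..1}. 0) \<le> B * Lp_norm p f)"

definition operator_entropy_number :: "real \<Rightarrow> (real \<Rightarrow> real \<Rightarrow> real) \<Rightarrow> nat \<Rightarrow> real"
  where "operator_entropy_number p K n =
    entropy_number C01 n (integral_operator K ` Lp_unit_ball p)"

(* k is meant as a function on (0,1].  The kernel below also uses the junk value k 0 on the
   diagonal x = t, a null set for each t. *)
definition WS_kernel :: "(real \<Rightarrow> real) \<Rightarrow> real \<Rightarrow> real \<Rightarrow> real"
  where "WS_kernel k t x = k \<bar>t - x\<bar>"

definition VO_kernel :: "(real \<Rightarrow> real) \<Rightarrow> real \<Rightarrow> real \<Rightarrow> real"
  where "VO_kernel k t x = (if x < t then k (t - x) else 0)"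

end

theory Submission
  imports Defs
begin

text \<open>
  Write \<open>q\<close> for the exponent conjugate to \<open>p\<close>, so that \<open>1 < q \<le> 2\<close>, and \<open>K\<^sub>t\<close> for the
  function \<open>K(t,\<cdot>)\<close>. The value of \<open>T\<^sub>K f\<close> at \<open>t\<close> is the pairing of \<open>f\<close> with \<open>K\<^sub>t\<close>, so only
  the curve \<open>t \<mapsto> K\<^sub>t\<close> in \<open>L\<^sub>q\<close> matters, and of it only the norms and the modulus of
  continuity \<open>\<Omega> a\<close>, which bounds the norm of \<open>K\<^sub>s - K\<^sub>t\<close> for \<open>|s - t| \<le> 2\<^sup>-\<^sup>a\<close>. The
  singularity of the profile \<open>k\<close> at zero determines it: up to a constant, \<open>\<Omega> a\<^sup>q\<close> is at most the
  integral of \<open>k\<^sup>q\<close> over \<open>[0, 2\<^sup>-\<^sup>a]\<close>, plus an error of order \<open>2\<^sup>-\<^sup>a\<close> when \<open>k\<close> is not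
  decreasing (lemma \<open>kernel_difference\<close>). So one may take \<open>\<Omega> a\<close> of order \<open>2\<^sup>-\<^sup>\<alpha>\<^sup>a\<close> with
  \<open>\<alpha> = 1/q - \<tau>\<close> in case (i), and of order \<open>(1 + a)\<^sup>-\<^sup>\<gamma>\<close> with \<open>\<gamma> = \<beta> - 1/q\<close> in case (ii).

  The heart of the proof is a way to encode the unit ball of \<open>L\<^sub>p\<close> with respect to finitely many
  functionals \<open>g\<^sub>a \<in> L\<^sub>q\<close> (lemma \<open>greedy_code\<close>). It plays the part of Maurey's
  approximation argument and of the duality of entropy numbers, and works directly in \<open>L\<^sub>p\<close>.
  Given \<open>f\<close> in the ball, keep a dual point \<open>z\<close>, a combination of the \<open>g\<^sub>a\<close>, and guess
  \<open>h = sgn(z) |z|\<^sup>q\<^sup>-\<^sup>1\<close>. As long as some \<open>g\<^sub>a\<close> distinguishes \<open>f\<close> from \<open>h\<close> by more than a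
  tolerance, add a multiple of \<open>g\<^sub>a\<close> to \<open>z\<close>. Since \<open>|\<cdot>|\<^sup>q\<close> is smooth of order \<open>q\<close>, every such step
  lowers the potential \<open>\<parallel>z\<parallel>\<^sup>q/q - \<langle>z,f\<rangle>\<close> by a definite amount, and by Young's inequality the
  potential never falls below \<open>- 1/p\<close>. So the procedure stops, and \<open>f\<close> is described up
  to the tolerances by the multiplicities with which the functionals were used. Each functional may
  have its own price \<open>w\<^sub>a\<close> in bits: with total budget \<open>x\<close> the tolerance is
  \<open>3 \<parallel>g\<^sub>a\<parallel> (w\<^sub>a/x)\<^sup>1\<^sup>/\<^sup>p\<close>. All functionals share one budget, and this is what makes the
  estimate sharp also in the critical case \<open>\<beta> = 1\<close>, where splitting the budget among the
  scales would lose a power of a logarithm. A Kraft type inequality (lemma \<open>card_weighted_counts\<close>) counts the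
  admissible multiplicities.

  The functionals are the increments of \<open>K\<close> along nested dyadic grids (lemma \<open>chaining\<close>). Adding the
  tolerances over the levels of the grids bounds the entropy numbers, and it remains to choose
  levels and prices. For a polynomial modulus every dyadic level is used, with a price that
  decreases geometrically below the level \<open>L\<close> at which the grid has about \<open>n\<close> points and increases
  linearly above it. For a logarithmic modulus the levels are \<open>L, 2L, 4L, \<dots>\<close> with
  \<open>4\<^sup>L \<approx> n\<close>, and the tolerances form a geometric series with ratio \<open>2\<^sup>1\<^sup>-\<^sup>\<beta>\<close>: its last term
  dominates for \<open>\<beta> < 1\<close>, its first term for \<open>\<beta> > 1\<close>, and for \<open>\<beta> = 1\<close> all
  of the about \<open>log n\<close> terms are equal.
\<close>

section \<open>Signed powers and conjugate exponents\<close>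

definition signed_power :: "real \<Rightarrow> real \<Rightarrow> real"
  where "signed_power \<theta> x = sgn x * \<bar>x\<bar> powr \<theta>"

lemma abs_signed_power: "\<bar>signed_power \<theta> x\<bar> = \<bar>x\<bar> powr \<theta>"
  by (auto simp: signed_power_def abs_mult abs_sgn_eq)

lemma signed_power_mult_self: "signed_power \<theta> x * x = \<bar>x\<bar> powr (\<theta> + 1)"
  by (cases "0 :: real" x rule: linorder_cases) (auto simp: signed_power_def powr_add)

lemma powr_add_le:
  fixes a b \<theta> :: real
  assumes "0 \<le> a" "0 \<le> b" "0 < \<theta>" "\<theta> \<le> 1"
  shows "(a + b) powr \<theta> \<le> a powr \<theta> + b powr \<theta>"
proof (cases "a + b = 0")
  case False
  then have s: "a + b > 0" using assms by simp
  have *: "x / (a + b) \<le> (x / (a + b)) powr \<theta>" if "0 \<le> x" "x \<le> a + b" for x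
  proof (cases "x = 0")
    case False
    with that s have "0 < x / (a + b)" "x / (a + b) \<le> 1" by auto
    then show ?thesis using powr_mono'[of \<theta> 1 "x / (a+b)"] assms
      by (simp only: powr_one)
  qed simp
  have "1 = a / (a + b) + b / (a + b)" using s by (simp add: add_divide_distrib[symmetric])
  also have "\<dots> \<le> (a / (a + b)) powr \<theta> + (b / (a + b)) powr \<theta>"
    using *[of a] *[of b] assms by simp
  also have "\<dots> = (a powr \<theta> + b powr \<theta>) / (a + b) powr \<theta>"
    using assms s by (simp add: powr_divide add_divide_distrib)
  finally show ?thesis using s by (simp add: field_simps)
qed (use assms in auto)

lemma signed_power_minus: "signed_power \<theta> (- x) = - signed_power \<theta> x"
  by (simp add: signed_power_def)

text \<open>Subadditivity of the concave power settles arguments of equal sign; for opposite signs both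
  powers are at most the power of the distance, which is where the factor two comes from.\<close>
lemma signed_power_Holder_continuous:
  assumes "0 < \<theta>" "\<theta> \<le> 1"
  shows "\<bar>signed_power \<theta> a - signed_power \<theta> b\<bar> \<le> 2 * \<bar>a - b\<bar> powr \<theta>"
proof -
  have mono: "x powr \<theta> \<le> y powr \<theta>" if "0 \<le> x" "x \<le> y" for x y :: real
    using that assms by (simp add: powr_mono2)
  have same: "\<bar>x powr \<theta> - y powr \<theta>\<bar> \<le> 2 * \<bar>x - y\<bar> powr \<theta>" if "0 \<le> x" "0 \<le> y" for x y :: real
  proof -
    have 1: "x powr \<theta> \<le> y powr \<theta> + \<bar>x - y\<bar> powr \<theta>"
      using powr_add_le[of y "\<bar>x - y\<bar>" \<theta>] mono[of x "y + \<bar>x - y\<bar>"] that assms by linarith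
    have 2: "y powr \<theta> \<le> x powr \<theta> + \<bar>x - y\<bar> powr \<theta>"
      using powr_add_le[of x "\<bar>x - y\<bar>" \<theta>] mono[of y "x + \<bar>x - y\<bar>"] that assms by linarith
    show ?thesis using 1 2 powr_ge_zero[of "\<bar>x - y\<bar>" \<theta>] by linarith
  qed
  have pos: "signed_power \<theta> x = x powr \<theta>" if "0 \<le> x" for x
    using that by (cases "x = 0") (auto simp: signed_power_def)
  have opposite: "\<bar>x powr \<theta> + y powr \<theta>\<bar> \<le> 2 * (x + y) powr \<theta>" if "0 \<le> x" "0 \<le> y" for x y :: real
    using mono[of x "x + y"] mono[of y "x + y"] that powr_ge_zero[of x \<theta>] powr_ge_zero[of y \<theta>] by linarith
  consider "0 \<le> a" "0 \<le> b" | "a \<le> 0" "b \<le> 0" | "0 \<le> a" "b \<le> 0" | "a \<le> 0" "0 \<le> b" by linarith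
  then show ?thesis
  proof cases
    case 1 then show ?thesis using same[of a b] pos by simp
  next
    case 2 then show ?thesis
      using same[of "-a" "-b"] pos[of "-a"] pos[of "-b"] by (simp add: signed_power_minus abs_minus_commute)
  next
    case 3
    then have "signed_power \<theta> a - signed_power \<theta> b = a powr \<theta> + (- b) powr \<theta>"
      using pos[of a] pos[of "-b"] signed_power_minus[of \<theta> b] by simp
    then show ?thesis using opposite[of a "-b"] 3 by simp
  next
    case 4
    then have "signed_power \<theta> b - signed_power \<theta> a = b powr \<theta> + (- a) powr \<theta>"
      using pos[of b] pos[of "-a"] signed_power_minus[of \<theta> a] by simp
    then show ?thesis
      using opposite[of b "-a"] 4 by (simp add: abs_minus_commute[of "signed_power \<theta> a"])
  qed
qed

locale conjugate_exponents =
  fixes p q :: real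
  assumes p_ge_2: "2 \<le> p" and conjugate: "1 / p + 1 / q = 1"
begin

lemma p_pos: "0 < p" using p_ge_2 by simp

lemma q_gt_1: "1 < q" and q_le_2: "q \<le> 2" and q_minus_1_mult_p: "(q - 1) * p = q"
proof -
  have q0: "q \<noteq> 0" using conjugate p_ge_2 by (auto simp: field_simps)
  have e: "q * (p - 1) = p" using conjugate q0 p_ge_2 by (simp add: field_simps)
  then have qe: "q = p / (p - 1)" using p_ge_2 by (simp add: field_simps)
  show "1 < q" "q \<le> 2" using p_ge_2 by (simp_all add: qe field_simps)
  show "(q - 1) * p = q" using e by (simp add: algebra_simps)
qed

lemma q_pos: "0 < q" using q_gt_1 by simp

lemma Young: "a * b \<le> \<bar>a\<bar> powr q / q + \<bar>b\<bar> powr p / p"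
proof -
  have "a * b \<le> \<bar>a\<bar> * \<bar>b\<bar>" by (metis abs_ge_self abs_mult)
  also have "\<dots> \<le> \<bar>a\<bar> powr q / q + \<bar>b\<bar> powr p / p"
    using Youngs_inequality[of q p "\<bar>a\<bar>" "\<bar>b\<bar>"] conjugate q_gt_1 p_ge_2 by simp
  finally show ?thesis .
qed

text \<open>Smoothness of order \<open>q\<close> of \<open>|\<cdot>|\<^sup>q/q\<close>. Young's inequality says that the tangent
  at \<open>x + y\<close> lies below the graph; moving the slope from \<open>x + y\<close> to \<open>x\<close> costs at most
  \<open>2 |y|\<^sup>q\<close>, because the derivative, the signed power, is Hoelder continuous of order
  \<open>q - 1 \<le> 1\<close>.\<close>
lemma powr_q_smooth:
  "\<bar>x + y\<bar> powr q / q \<le> \<bar>x\<bar> powr q / q + signed_power (q - 1) x * y + 2 * \<bar>y\<bar> powr q"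
proof -
  let ?\<phi> = "signed_power (q - 1)"
  have "?\<phi> (x + y) * x \<le> \<bar>x\<bar> powr q / q + \<bar>x + y\<bar> powr q / p"
    using Young[of x "?\<phi> (x + y)"]
    unfolding abs_signed_power powr_powr q_minus_1_mult_p by (simp add: mult.commute)
  moreover have "?\<phi> (x + y) * x + ?\<phi> (x + y) * y = \<bar>x + y\<bar> powr q"
    using signed_power_mult_self[of "q - 1" "x + y"] by (simp add: algebra_simps)
  moreover have "\<bar>x + y\<bar> powr q / p + \<bar>x + y\<bar> powr q / q = \<bar>x + y\<bar> powr q"
    using conjugate by (metis distrib_left mult.right_neutral times_divide_eq_right)
  ultimately have conv: "\<bar>x + y\<bar> powr q / q \<le> \<bar>x\<bar> powr q / q + ?\<phi> (x + y) * y" by linarith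
  have "(?\<phi> (x + y) - ?\<phi> x) * y \<le> \<bar>?\<phi> (x + y) - ?\<phi> x\<bar> * \<bar>y\<bar>"
    by (metis abs_ge_self abs_mult)
  also have "\<dots> \<le> (2 * \<bar>y\<bar> powr (q - 1)) * \<bar>y\<bar>"
    using signed_power_Holder_continuous[of "q - 1" "x + y" x] q_gt_1 q_le_2
    by (intro mult_right_mono) auto
  also have "\<dots> = 2 * \<bar>y\<bar> powr q"
    by (cases "y = 0") (auto simp: powr_diff)
  finally show ?thesis using conv by (simp add: algebra_simps)
qed

end

section \<open>Integrability and Hoelder inequality on the unit interval\<close>

abbreviation unit_interval_measure :: "real measure" ("\<mu>")
  where "\<mu> \<equiv> lebesgue_on {0..1}"

lemma powr_abs_add_le:
  fixes x y s :: real
  assumes "0 < s"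
  shows "\<bar>x + y\<bar> powr s \<le> 2 powr s * (\<bar>x\<bar> powr s + \<bar>y\<bar> powr s)"
proof -
  have "\<bar>x + y\<bar> powr s \<le> (2 * max \<bar>x\<bar> \<bar>y\<bar>) powr s"
    using assms by (intro powr_mono2) auto
  also have "\<dots> = 2 powr s * (max \<bar>x\<bar> \<bar>y\<bar>) powr s" by (simp add: powr_mult)
  also have "(max \<bar>x\<bar> \<bar>y\<bar>) powr s \<le> \<bar>x\<bar> powr s + \<bar>y\<bar> powr s"
    by (auto simp: max_def)
  finally show ?thesis by simp
qed

lemma Lp_measurable: "f \<in> Lp s \<Longrightarrow> f \<in> borel_measurable \<mu>"
  and Lp_integrable: "f \<in> Lp s \<Longrightarrow> integrable \<mu> (\<lambda>x. \<bar>f x\<bar> powr s)"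
  by (auto simp: Lp_def)

lemma Lp_zero: "0 < s \<Longrightarrow> (\<lambda>x. 0) \<in> Lp s"
  by (simp add: Lp_def)

lemma Lp_add:
  assumes "0 < s" "f \<in> Lp s" "g \<in> Lp s"
  shows "(\<lambda>x. f x + g x) \<in> Lp s"
proof -
  note [measurable] = Lp_measurable[OF assms(2)] Lp_measurable[OF assms(3)]
  have "integrable \<mu> (\<lambda>x. \<bar>f x + g x\<bar> powr s)"
    by (rule Bochner_Integration.integrable_bound[of _ "\<lambda>x. 2 powr s * (\<bar>f x\<bar> powr s + \<bar>g x\<bar> powr s)"])
       (use assms powr_abs_add_le[OF assms(1)] in
         \<open>auto intro!: integrable_mult_right Bochner_Integration.integrable_add Lp_integrable simp: abs_mult\<close>)
  then show ?thesis unfolding Lp_def by simp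
qed

lemma Lp_cmult:
  assumes "f \<in> Lp s" shows "(\<lambda>x. c * f x) \<in> Lp s"
  using assms by (auto simp: Lp_def abs_mult powr_mult)

lemma Lp_diff:
  assumes "0 < s" "f \<in> Lp s" "g \<in> Lp s"
  shows "(\<lambda>x. f x - g x) \<in> Lp s"
  using Lp_add[OF assms(1,2) Lp_cmult[OF assms(3), of "-1"]] by simp

lemma Lp_sum:
  assumes "0 < s" "\<And>a. a \<in> A \<Longrightarrow> f a \<in> Lp s"
  shows "(\<lambda>x. \<Sum>a\<in>A. f a x) \<in> Lp s"
  using assms(2)
  by (induction A rule: infinite_finite_induct) (auto intro: Lp_add Lp_zero assms(1))

lemma Lp_norm_nonneg: "0 \<le> Lp_norm s f" by (simp add: Lp_norm_def)

lemma Lp_norm_powr: "0 < s \<Longrightarrow> Lp_norm s f powr s = (\<integral>x. \<bar>f x\<bar> powr s \<partial>\<mu>)"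
  by (simp add: Lp_norm_def powr_powr)

lemma integral_powr_le:
  "0 < s \<Longrightarrow> Lp_norm s f \<le> r \<Longrightarrow> (\<integral>x. \<bar>f x\<bar> powr s \<partial>\<mu>) \<le> r powr s"
  by (metis Lp_norm_nonneg Lp_norm_powr powr_mono2 less_eq_real_def)

lemma Lp_norm_le:
  assumes "0 < s" "0 \<le> r" "(\<integral>x. \<bar>f x\<bar> powr s \<partial>\<mu>) \<le> r powr s"
  shows "Lp_norm s f \<le> r"
proof -
  have "Lp_norm s f \<le> (r powr s) powr (1 / s)"
    unfolding Lp_norm_def using assms by (intro powr_mono2) auto
  then show ?thesis using assms by (simp add: powr_powr)
qed

lemma Lp_norm_cmult:
  assumes "0 < s" shows "Lp_norm s (\<lambda>x. c * f x) = \<bar>c\<bar> * Lp_norm s f"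
  using assms by (simp add: Lp_norm_def abs_mult powr_mult powr_powr)

lemma Lp_norm_eq_0_AE:
  assumes "0 < s" "f \<in> Lp s" "Lp_norm s f = 0"
  shows "AE x in \<mu>. f x = 0"
proof -
  have "(\<integral>x. \<bar>f x\<bar> powr s \<partial>\<mu>) = 0" using assms by (metis Lp_norm_powr powr_0)
  then have "AE x in \<mu>. \<bar>f x\<bar> powr s = 0"
    using integral_nonneg_eq_0_iff_AE[OF Lp_integrable[OF assms(2)]] by simp
  then show ?thesis by simp
qed

context conjugate_exponents begin

lemma pairing_integrable:
  assumes "g \<in> Lp q" "f \<in> Lp p"
  shows "integrable \<mu> (\<lambda>x. g x * f x)"
proof -
  note [measurable] = Lp_measurable[OF assms(1)] Lp_measurable[OF assms(2)]
  show ?thesis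
  proof (rule Bochner_Integration.integrable_bound[of _ "\<lambda>x. \<bar>g x\<bar> powr q / q + \<bar>f x\<bar> powr p / p"])
    show "integrable \<mu> (\<lambda>x. \<bar>g x\<bar> powr q / q + \<bar>f x\<bar> powr p / p)"
      using assms by (intro Bochner_Integration.integrable_add Bochner_Integration.integrable_divide Lp_integrable) auto
    show "AE x in \<mu>. norm (g x * f x) \<le> norm (\<bar>g x\<bar> powr q / q + \<bar>f x\<bar> powr p / p)"
      using Young[of "\<bar>g x\<bar>" "\<bar>f x\<bar>" for x]
      by (intro AE_I2) (simp add: abs_mult order.trans[OF _ abs_ge_self])
  qed measurable
qed

lemma Young_integral:
  assumes "g \<in> Lp q" "f \<in> Lp p"
  shows "(\<integral>x. g x * f x \<partial>\<mu>) \<le> (\<integral>x. \<bar>g x\<bar> powr q \<partial>\<mu>) / q + (\<integral>x. \<bar>f x\<bar> powr p \<partial>\<mu>) / p"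
proof -
  have "(\<integral>x. g x * f x \<partial>\<mu>) \<le> (\<integral>x. \<bar>g x\<bar> powr q / q + \<bar>f x\<bar> powr p / p \<partial>\<mu>)"
    using assms by (intro integral_mono pairing_integrable Bochner_Integration.integrable_add
        Bochner_Integration.integrable_divide Lp_integrable Young) auto
  also have "\<dots> = (\<integral>x. \<bar>g x\<bar> powr q \<partial>\<mu>) / q + (\<integral>x. \<bar>f x\<bar> powr p \<partial>\<mu>) / p"
    using assms by (subst Bochner_Integration.integral_add) (auto intro!: Bochner_Integration.integrable_divide Lp_integrable)
  finally show ?thesis .
qed

text \<open>Young's inequality for the normalised functions.\<close>
lemma Holder_aux:
  assumes "g \<in> Lp q" "f \<in> Lp p"
  shows "(\<integral>x. g x * f x \<partial>\<mu>) \<le> Lp_norm q g * Lp_norm p f"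
proof -
  consider "Lp_norm q g = 0" | "Lp_norm p f = 0" | "0 < Lp_norm q g" "0 < Lp_norm p f"
    using Lp_norm_nonneg[of q g] Lp_norm_nonneg[of p f] by linarith
  then show ?thesis
  proof cases
    case 1
    then have "AE x in \<mu>. g x * f x = 0"
      using Lp_norm_eq_0_AE[OF q_pos assms(1)] by auto
    then have "(\<integral>x. g x * f x \<partial>\<mu>) = 0" by (rule integral_eq_zero_AE)
    with 1 show ?thesis by simp
  next
    case 2
    then have "AE x in \<mu>. g x * f x = 0"
      using Lp_norm_eq_0_AE[OF p_pos assms(2)] by auto
    then have "(\<integral>x. g x * f x \<partial>\<mu>) = 0" by (rule integral_eq_zero_AE)
    with 2 show ?thesis by simp
  next
    case 3
    define a b where "a = Lp_norm q g" and "b = Lp_norm p f"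
    have ab: "0 < a" "0 < b" using 3 by (auto simp: a_def b_def)
    have "(\<integral>x. (1 / a * g x) * (1 / b * f x) \<partial>\<mu>)
        \<le> (\<integral>x. \<bar>1 / a * g x\<bar> powr q \<partial>\<mu>) / q + (\<integral>x. \<bar>1 / b * f x\<bar> powr p \<partial>\<mu>) / p"
      by (intro Young_integral Lp_cmult assms)
    also have "\<dots> = 1 / q + 1 / p"
      using ab Lp_norm_powr[OF q_pos, of "\<lambda>x. 1 / a * g x"] Lp_norm_powr[OF p_pos, of "\<lambda>x. 1 / b * f x"]
      unfolding Lp_norm_cmult[OF q_pos] Lp_norm_cmult[OF p_pos]
      by (simp flip: a_def b_def)
    also have "\<dots> = 1" using conjugate by simp
    also have "(\<integral>x. (1 / a * g x) * (1 / b * f x) \<partial>\<mu>) = (\<integral>x. g x * f x \<partial>\<mu>) / (a * b)"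
      by simp
    finally show ?thesis using ab by (simp add: a_def b_def field_simps)
  qed
qed

lemma Holder:
  assumes "g \<in> Lp q" "f \<in> Lp p"
  shows "\<bar>\<integral>x. g x * f x \<partial>\<mu>\<bar> \<le> Lp_norm q g * Lp_norm p f"
  using Holder_aux[OF assms] Holder_aux[OF Lp_cmult[OF assms(1), of "-1"] assms(2)]
  unfolding Lp_norm_cmult[OF q_pos] by simp

lemma signed_power_Lp:
  assumes "z \<in> Lp q"
  shows "(\<lambda>x. signed_power (q - 1) (z x)) \<in> Lp p"
proof -
  note [measurable] = Lp_measurable[OF assms]
  show ?thesis
    unfolding Lp_def mem_Collect_eq abs_signed_power powr_powr q_minus_1_mult_p
    using Lp_integrable[OF assms] unfolding signed_power_def by simp
qed

end

section \<open>Counting weighted codes\<close>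

text \<open>The logarithm of the geometric series \<open>1 + 2\<^sup>-\<^sup>w + 2\<^sup>-\<^sup>2\<^sup>w + \<dots>\<close>: what a counter of unit price
  \<open>w\<close> adds to the length of a code. An expensive counter is almost free
  (lemma \<open>bit_cost_large\<close>), since it is rarely used, and even for a very cheap counter the
  charge is only logarithmic in the price (lemma \<open>bit_cost_small\<close>).\<close>
definition bit_cost :: "real \<Rightarrow> real"
  where "bit_cost w = - log 2 (1 - 2 powr (- w))"

text \<open>Kraft's inequality: give a family of counters \<open>\<nu>\<close> the mass
  \<open>\<Prod>a. 2\<^sup>-\<^sup>w\<^sup>(\<^sup>a\<^sup>)\<^sup>\<nu>\<^sup>(\<^sup>a\<^sup>)\<close>. Every family in the set has mass at least \<open>2\<^sup>-\<^sup>x\<close>, and the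
  total mass of all families is a product of geometric series.\<close>
lemma card_weighted_counts:
  fixes w :: "'a \<Rightarrow> real" and x :: real and A :: "'a set"
  defines "S \<equiv> {\<nu> \<in> A \<rightarrow>\<^sub>E (UNIV :: nat set). (\<Sum>a\<in>A. w a * real (\<nu> a)) \<le> x}"
  assumes A: "finite A" and w: "\<And>a. a \<in> A \<Longrightarrow> 0 < w a"
  shows "finite S" "real (card S) \<le> 2 powr (x + (\<Sum>a\<in>A. bit_cost (w a)))"
proof -
  define B where "B a = {..nat \<lceil>x / w a\<rceil>}" for a
  have sub: "S \<subseteq> PiE A B"
  proof
    fix \<nu> assume \<nu>: "\<nu> \<in> S"
    have "\<nu> a \<le> nat \<lceil>x / w a\<rceil>" if "a \<in> A" for a
    proof -
      have "w a * real (\<nu> a) \<le> (\<Sum>a\<in>A. w a * real (\<nu> a))"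
        using A that w by (intro member_le_sum) (auto simp: less_imp_le)
      also have "\<dots> \<le> x" using \<nu> by (simp add: S_def)
      finally have "real (\<nu> a) \<le> x / w a" using w[OF that] by (simp add: field_simps)
      then show ?thesis by linarith
    qed
    with \<nu> show "\<nu> \<in> PiE A B" by (auto simp: S_def B_def PiE_iff)
  qed
  have finP: "finite (PiE A B)" by (auto intro: finite_PiE A simp: B_def)
  show "finite S" by (rule finite_subset[OF sub finP])
  have y: "0 < 2 powr (- w a)" "2 powr (- w a) < 1" if "a \<in> A" for a
    using w[OF that] by (auto simp: powr_less_one)
  have "real (card S) * 2 powr (- x) = (\<Sum>\<nu>\<in>S. 2 powr (- x))" by simp
  also have "\<dots> \<le> (\<Sum>\<nu>\<in>S. \<Prod>a\<in>A. (2 powr (- w a)) ^ \<nu> a)"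
  proof (rule sum_mono)
    fix \<nu> assume "\<nu> \<in> S"
    then have "2 powr (- x) \<le> 2 powr (- (\<Sum>a\<in>A. w a * real (\<nu> a)))" by (simp add: S_def)
    also have "\<dots> = (\<Prod>a\<in>A. (2 powr (- w a)) ^ \<nu> a)"
      using A by (simp add: powr_sum powr_powr flip: powr_realpow sum_negf)
    finally show "2 powr (- x) \<le> (\<Prod>a\<in>A. (2 powr (- w a)) ^ \<nu> a)" .
  qed
  also have "\<dots> \<le> (\<Sum>\<nu>\<in>PiE A B. \<Prod>a\<in>A. (2 powr (- w a)) ^ \<nu> a)"
    by (intro sum_mono2 finP sub prod_nonneg) auto
  also have "\<dots> = (\<Prod>a\<in>A. \<Sum>j\<in>B a. (2 powr (- w a)) ^ j)"
    by (rule prod_sum_PiE[symmetric]) (auto simp: A B_def)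
  also have "\<dots> \<le> (\<Prod>a\<in>A. 1 / (1 - 2 powr (- w a)))"
  proof (rule prod_mono, safe)
    fix a assume a: "a \<in> A"
    show "0 \<le> (\<Sum>j\<in>B a. (2 powr (- w a)) ^ j)" by (intro sum_nonneg) auto
    have "(\<Sum>j\<in>B a. (2 powr (- w a)) ^ j) \<le> (\<Sum>j. (2 powr (- w a)) ^ j)"
      using y[OF a] by (intro sum_le_suminf summable_geometric) (auto simp: B_def)
    also have "\<dots> = 1 / (1 - 2 powr (- w a))"
      using y[OF a] by (intro suminf_geometric) auto
    finally show "(\<Sum>j\<in>B a. (2 powr (- w a)) ^ j) \<le> 1 / (1 - 2 powr (- w a))" .
  qed
  also have "\<dots> = (\<Prod>a\<in>A. 2 powr bit_cost (w a))"
    using y by (intro prod.cong) (auto simp: bit_cost_def powr_minus divide_inverse)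
  also have "\<dots> = 2 powr (\<Sum>a\<in>A. bit_cost (w a))" using A by (simp add: powr_sum)
  finally show "real (card S) \<le> 2 powr (x + (\<Sum>a\<in>A. bit_cost (w a)))"
    by (simp add: powr_add powr_minus field_simps)
qed

text \<open>A convex function lies below its chord.\<close>
lemma two_powr_minus_le:
  fixes w :: real
  assumes "0 \<le> w" "w \<le> 1" shows "2 powr (- w) \<le> 1 - w / 2"
  using Youngs_inequality_0[of w "1 - w" "1 / 2" 1] assms
  by (simp add: powr_divide powr_minus_divide)

lemma bit_cost_large:
  assumes "1 \<le> w" shows "bit_cost w \<le> 2 * 2 powr (- w)"
proof -
  let ?d = "2 powr (- w)"
  have "?d \<le> 2 powr (- 1 :: real)" using assms by (intro powr_mono) auto
  then have d: "?d \<le> 1 / 2" by (simp add: powr_minus)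
  have "2 powr (- (2 * ?d)) \<le> 1 - ?d" using two_powr_minus_le[of "2 * ?d"] d by simp
  then have "log 2 (2 powr (- (2 * ?d))) \<le> log 2 (1 - ?d)" using d by (intro log_mono) auto
  then show ?thesis by (simp add: bit_cost_def)
qed

lemma bit_cost_small:
  assumes "0 < w" "w \<le> 1" shows "bit_cost w \<le> 1 - log 2 w"
proof -
  have "log 2 (w / 2) \<le> log 2 (1 - 2 powr (- w))"
    using two_powr_minus_le[of w] assms by (intro log_mono) auto
  then show ?thesis using assms by (simp add: bit_cost_def log_divide)
qed

section \<open>Encoding the unit ball by mirror descent\<close>

context conjugate_exponents begin

text \<open>The guess made from the multiplicities \<open>\<nu>\<close>. The step size \<open>(w/x)\<^sup>1\<^sup>/\<^sup>q / r\<close> balances the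
  linear gain of a step against the error term of \<open>powr_q_smooth\<close>.\<close>
definition decode ::
    "'a set \<Rightarrow> ('a \<Rightarrow> real \<Rightarrow> real) \<Rightarrow> ('a \<Rightarrow> real) \<Rightarrow> ('a \<Rightarrow> real) \<Rightarrow> real \<Rightarrow> ('a \<Rightarrow> nat) \<Rightarrow> real \<Rightarrow> real"
  where "decode A g r w x \<nu> t =
    signed_power (q - 1) (\<Sum>a\<in>A. real (\<nu> a) * ((w a / x) powr (1 / q) / r a * g a t))"

lemma decode_Lp:
  assumes "\<And>a. a \<in> A \<Longrightarrow> g a \<in> Lp q"
  shows "decode A g r w x \<nu> \<in> Lp p"
proof -
  have "(\<lambda>t. \<Sum>a\<in>A. real (\<nu> a) * ((w a / x) powr (1 / q) / r a * g a t)) \<in> Lp q"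
    by (intro Lp_sum Lp_cmult assms q_pos)
  then show ?thesis
    unfolding decode_def[abs_def] by (rule signed_power_Lp)
qed

text \<open>Instead of running the procedure, take \<open>\<nu>\<close> with maximal total price \<open>W \<nu>\<close> among those
  whose potential \<open>V \<nu>\<close> is at most \<open>- W \<nu> / x\<close>. As \<open>V\<close> is bounded below by \<open>-1\<close>, the price is at most
  \<open>x\<close>. A functional that violates its tolerance could be used once more: the potential would drop by
  at least \<open>w\<^sub>a/x\<close>, and \<open>\<nu>\<close> would not be maximal.

  The tolerance is one-sided, so that the decoder need not know a sign; it becomes two-sided when
  the family of functionals is closed under negation.\<close>
lemma greedy_code:
  fixes g :: "'a \<Rightarrow> real \<Rightarrow> real" and r w :: "'a \<Rightarrow> real" and x :: real
  assumes A: "finite A" and g: "\<And>a. a \<in> A \<Longrightarrow> g a \<in> Lp q"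
    and r: "\<And>a. a \<in> A \<Longrightarrow> Lp_norm q (g a) \<le> r a" "\<And>a. a \<in> A \<Longrightarrow> 0 < r a"
    and w: "\<And>a. a \<in> A \<Longrightarrow> 0 < w a" and x: "0 < x"
    and f: "f \<in> Lp_unit_ball p"
  obtains \<nu> where "\<nu> \<in> A \<rightarrow>\<^sub>E UNIV" "(\<Sum>a\<in>A. w a * real (\<nu> a)) \<le> x"
    "\<And>a. a \<in> A \<Longrightarrow>
       (\<integral>t. g a t * (f t - decode A g r w x \<nu> t) \<partial>\<mu>) \<le> 3 * r a * (w a / x) powr (1 / p)"
proof -
  define c where "c a = (w a / x) powr (1 / q) / r a" for a
  define z where "z \<nu> = (\<lambda>t. \<Sum>a\<in>A. real (\<nu> a) * (c a * g a t))" for \<nu> :: "'a \<Rightarrow> nat"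
  note z = z_def
  have dec: "decode A g r w x \<nu> = (\<lambda>t. signed_power (q - 1) (z \<nu> t))" for \<nu>
    by (simp add: decode_def z_def c_def fun_eq_iff)
  have zL: "z \<nu> \<in> Lp q" for \<nu>
    unfolding z by (intro Lp_sum Lp_cmult g q_pos)
  have fL: "f \<in> Lp p" and f1: "(\<integral>t. \<bar>f t\<bar> powr p \<partial>\<mu>) \<le> 1"
    using f integral_powr_le[OF p_pos, of f 1] by (auto simp: Lp_unit_ball_def)
  define V where "V \<nu> = (\<integral>t. \<bar>z \<nu> t\<bar> powr q \<partial>\<mu>) / q - (\<integral>t. z \<nu> t * f t \<partial>\<mu>)" for \<nu>
  define W where "W \<nu> = (\<Sum>a\<in>A. w a * real (\<nu> a))" for \<nu>
  have V_ge: "-1 \<le> V \<nu>" for \<nu>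
  proof -
    have "(\<integral>t. \<bar>f t\<bar> powr p \<partial>\<mu>) / p \<le> 1 / p" using f1 p_pos by (simp add: divide_right_mono)
    also have "\<dots> \<le> 1" using p_ge_2 by simp
    finally show ?thesis using Young_integral[OF zL fL, of \<nu>] unfolding V_def by linarith
  qed
  define S where "S = {\<nu> \<in> A \<rightarrow>\<^sub>E (UNIV :: nat set). V \<nu> \<le> - (W \<nu> / x)}"
  have S_W: "W \<nu> \<le> x" if "\<nu> \<in> S" for \<nu>
  proof -
    have "W \<nu> / x \<le> 1" using that V_ge[of \<nu>] by (auto simp: S_def)
    then show ?thesis using x by (simp add: field_simps)
  qed
  have "S \<subseteq> {\<nu> \<in> A \<rightarrow>\<^sub>E UNIV. (\<Sum>a\<in>A. w a * real (\<nu> a)) \<le> x}"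
    using S_W by (auto simp: S_def W_def)
  then have finS: "finite S" by (rule finite_subset) (rule card_weighted_counts(1)[OF A w])
  have "(\<lambda>a\<in>A. 0) \<in> S"
    using q_pos by (simp add: S_def V_def W_def z)
  then have "S \<noteq> {}" by blast
  then have "Max (W ` S) \<in> W ` S" using finS by (intro Max_in) auto
  then obtain \<nu> where \<nu>: "\<nu> \<in> S" and "W \<nu> = Max (W ` S)" by force
  then have max: "W \<kappa> \<le> W \<nu>" if "\<kappa> \<in> S" for \<kappa>
    using that finS by simp
  show ?thesis
  proof (rule that[of \<nu>])
    show "\<nu> \<in> A \<rightarrow>\<^sub>E UNIV" using \<nu> by (simp add: S_def)
    show "(\<Sum>a\<in>A. w a * real (\<nu> a)) \<le> x" using S_W[OF \<nu>] by (simp add: W_def)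
    fix a assume a: "a \<in> A"
    define v where "v = w a / x"
    have v: "0 < v" using w[OF a] x by (simp add: v_def)
    let ?h = "\<lambda>t. signed_power (q - 1) (z \<nu> t)"
    define I where "I = (\<integral>t. g a t * (f t - ?h t) \<partial>\<mu>)"
    have hL: "?h \<in> Lp p" by (rule signed_power_Lp[OF zL])
    have c_a: "c a = v powr (1 / q) / r a" by (simp add: c_def v_def)
    have ca: "0 < c a" using r(2)[OF a] v unfolding c_a by simp
    have cgL: "(\<lambda>t. c a * g a t) \<in> Lp q" by (intro Lp_cmult g a)
    define \<kappa> where "\<kappa> = \<nu>(a := \<nu> a + 1)"
    have \<kappa>: "\<kappa> \<in> A \<rightarrow>\<^sub>E UNIV" using \<nu> a by (auto simp: S_def \<kappa>_def PiE_iff extensional_def)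
    have upd: "(\<Sum>b\<in>A. real (\<kappa> b) * F b) = (\<Sum>b\<in>A. real (\<nu> b) * F b) + F a" for F :: "'a \<Rightarrow> real"
    proof -
      have "(\<Sum>b\<in>A. real (\<kappa> b) * F b) = (\<Sum>b\<in>A. real (\<nu> b) * F b + (if b = a then F a else 0))"
        by (intro sum.cong) (auto simp: \<kappa>_def algebra_simps)
      also have "\<dots> = (\<Sum>b\<in>A. real (\<nu> b) * F b) + F a"
        using A a by (simp add: sum.distrib)
      finally show ?thesis .
    qed
    have W\<kappa>: "W \<kappa> = W \<nu> + w a"
      using upd[of w] by (simp add: W_def mult.commute)
    have z\<kappa>: "z \<kappa> = (\<lambda>t. z \<nu> t + c a * g a t)"
      unfolding z upd ..
    have "(\<integral>t. \<bar>z \<kappa> t\<bar> powr q / q \<partial>\<mu>)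
        \<le> (\<integral>t. (\<bar>z \<nu> t\<bar> powr q / q + (c a * g a t) * ?h t) + 2 * \<bar>c a * g a t\<bar> powr q \<partial>\<mu>)"
      unfolding z\<kappa>
      by (intro integral_mono Bochner_Integration.integrable_add Bochner_Integration.integrable_divide
           integrable_mult_right Lp_integrable Lp_add zL cgL q_pos pairing_integrable hL)
         (use powr_q_smooth in \<open>simp add: mult.commute\<close>)
    also have "\<dots> = (\<integral>t. \<bar>z \<nu> t\<bar> powr q / q + (c a * g a t) * ?h t \<partial>\<mu>)
        + (\<integral>t. 2 * \<bar>c a * g a t\<bar> powr q \<partial>\<mu>)"
      by (intro Bochner_Integration.integral_add Bochner_Integration.integrable_add
          Bochner_Integration.integrable_divide integrable_mult_right Lp_integrable zL cgL
          pairing_integrable hL)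
    also have "(\<integral>t. \<bar>z \<nu> t\<bar> powr q / q + (c a * g a t) * ?h t \<partial>\<mu>)
        = (\<integral>t. \<bar>z \<nu> t\<bar> powr q / q \<partial>\<mu>) + (\<integral>t. (c a * g a t) * ?h t \<partial>\<mu>)"
      by (intro Bochner_Integration.integral_add Bochner_Integration.integrable_divide
          Lp_integrable zL cgL pairing_integrable hL)
    finally have 1: "(\<integral>t. \<bar>z \<kappa> t\<bar> powr q \<partial>\<mu>) / q
        \<le> (\<integral>t. \<bar>z \<nu> t\<bar> powr q \<partial>\<mu>) / q + c a * (\<integral>t. g a t * ?h t \<partial>\<mu>)
          + 2 * (\<integral>t. \<bar>c a * g a t\<bar> powr q \<partial>\<mu>)"
      by (simp add: mult.assoc)
    have 2: "(\<integral>t. z \<kappa> t * f t \<partial>\<mu>) = (\<integral>t. z \<nu> t * f t \<partial>\<mu>) + c a * (\<integral>t. g a t * f t \<partial>\<mu>)"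
    proof -
      have "(\<integral>t. z \<kappa> t * f t \<partial>\<mu>) = (\<integral>t. z \<nu> t * f t + (c a * g a t) * f t \<partial>\<mu>)"
        unfolding z\<kappa> by (simp add: algebra_simps)
      also have "\<dots> = (\<integral>t. z \<nu> t * f t \<partial>\<mu>) + (\<integral>t. (c a * g a t) * f t \<partial>\<mu>)"
        by (intro Bochner_Integration.integral_add pairing_integrable zL cgL fL)
      finally show ?thesis by (simp add: mult.assoc)
    qed
    have 3: "I = (\<integral>t. g a t * f t \<partial>\<mu>) - (\<integral>t. g a t * ?h t \<partial>\<mu>)"
      unfolding right_diff_distrib I_def
      by (intro Bochner_Integration.integral_diff pairing_integrable g[OF a] fL hL)
    have "Lp_norm q (\<lambda>t. c a * g a t) \<le> c a * r a"
      unfolding Lp_norm_cmult[OF q_pos] using ca r(1)[OF a] by simp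
    also have "\<dots> = v powr (1 / q)" using r(2)[OF a] by (simp add: c_a)
    finally have 4: "(\<integral>t. \<bar>c a * g a t\<bar> powr q \<partial>\<mu>) \<le> v"
      using integral_powr_le[OF q_pos, of "\<lambda>t. c a * g a t" "v powr (1 / q)"] q_pos v
      by (simp add: powr_powr)
    have "V \<kappa> \<le> V \<nu> - c a * I + 2 * v"
      using 1 2 4 unfolding V_def 3 by (simp add: algebra_simps)
    moreover have "\<not> V \<kappa> \<le> V \<nu> - v"
    proof
      assume "V \<kappa> \<le> V \<nu> - v"
      then have "V \<kappa> \<le> - (W \<kappa> / x)"
        using \<nu> by (simp add: S_def W\<kappa> v_def add_divide_distrib)
      then have "\<kappa> \<in> S" using \<kappa> by (simp add: S_def)
      then show False using max[of \<kappa>] W\<kappa> w[OF a] by simp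
    qed
    ultimately have "c a * I \<le> 3 * v" by linarith
    also have "3 * v = c a * (3 * r a * v powr (1 / p))"
    proof -
      have "v powr (1 / q) * v powr (1 / p) = v"
        using v conjugate by (simp flip: powr_add add: add.commute)
      then show ?thesis using r(2)[OF a] by (simp add: c_a mult.commute)
    qed
    finally have "I \<le> 3 * r a * v powr (1 / p)" using ca by simp
    then show "(\<integral>t. g a t * (f t - decode A g r w x \<nu> t) \<partial>\<mu>) \<le> 3 * r a * (w a / x) powr (1 / p)"
      by (simp add: I_def v_def dec)
  qed
qed

end

section \<open>Operators whose kernel has a modulus of continuity\<close>

text \<open>The value \<open>\<Omega> 0\<close> bounds the norms of the \<open>K t\<close> themselves as well, so that no separate
  constant is required.\<close>
locale kernel_modulus = conjugate_exponents +
  fixes K :: "real \<Rightarrow> real \<Rightarrow> real" and \<Omega> :: "nat \<Rightarrow> real"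
  assumes K_Lq: "t \<in> {0..1} \<Longrightarrow> K t \<in> Lp q"
    and \<Omega>_pos: "0 < \<Omega> a"
    and \<Omega>_limit: "\<Omega> \<longlonglongrightarrow> 0"
    and norm_K: "t \<in> {0..1} \<Longrightarrow> Lp_norm q (K t) \<le> \<Omega> 0"
    and modulus: "s \<in> {0..1} \<Longrightarrow> t \<in> {0..1} \<Longrightarrow> \<bar>s - t\<bar> \<le> 1 / 2 ^ a \<Longrightarrow>
      Lp_norm q (\<lambda>x. K s x - K t x) \<le> \<Omega> a"
begin

lemma operator_apply:
  "t \<in> {0..1} \<Longrightarrow> integral_operator K f t = (\<integral>x. K t x * f x \<partial>\<mu>)"
  by (simp add: integral_operator_def)

lemma operator_diff:
  assumes "s \<in> {0..1}" "t \<in> {0..1}" "f \<in> Lp p"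
  shows "integral_operator K f s - integral_operator K f t = (\<integral>x. (K s x - K t x) * f x \<partial>\<mu>)"
  unfolding operator_apply[OF assms(1)] operator_apply[OF assms(2)] left_diff_distrib
  by (intro Bochner_Integration.integral_diff[symmetric] pairing_integrable K_Lq assms)

lemma operator_diff_le:
  assumes "s \<in> {0..1}" "t \<in> {0..1}" "\<bar>s - t\<bar> \<le> 1 / 2 ^ a" "f \<in> Lp p"
  shows "\<bar>integral_operator K f s - integral_operator K f t\<bar> \<le> \<Omega> a * Lp_norm p f"
proof -
  have "(\<lambda>x. K s x - K t x) \<in> Lp q" using assms by (intro Lp_diff K_Lq q_pos)
  from Holder[OF this assms(4)]
  have "\<bar>integral_operator K f s - integral_operator K f t\<bar>
      \<le> Lp_norm q (\<lambda>x. K s x - K t x) * Lp_norm p f"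
    using operator_diff assms by simp
  also have "\<dots> \<le> \<Omega> a * Lp_norm p f"
    using modulus[OF assms(1-3)] by (intro mult_right_mono Lp_norm_nonneg)
  finally show ?thesis .
qed

lemma operator_le:
  assumes "t \<in> {0..1}" "f \<in> Lp p"
  shows "\<bar>integral_operator K f t\<bar> \<le> \<Omega> 0 * Lp_norm p f"
proof -
  have "\<bar>integral_operator K f t\<bar> \<le> Lp_norm q (K t) * Lp_norm p f"
    using Holder[OF K_Lq[OF assms(1)] assms(2)] operator_apply[OF assms(1)] by simp
  also have "\<dots> \<le> \<Omega> 0 * Lp_norm p f"
    using norm_K[OF assms(1)] by (intro mult_right_mono Lp_norm_nonneg)
  finally show ?thesis .
qed

lemma operator_continuous:
  assumes f: "f \<in> Lp p"
  shows "continuous_on {0..1} (integral_operator K f)"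
  unfolding continuous_on_iff
proof (intro ballI allI impI)
  fix t e :: real assume t: "t \<in> {0..1}" and e: "0 < e"
  have "(\<lambda>a. \<Omega> a * Lp_norm p f) \<longlonglongrightarrow> 0 * Lp_norm p f"
    by (intro tendsto_intros \<Omega>_limit)
  then have "\<forall>\<^sub>F a in sequentially. \<Omega> a * Lp_norm p f < e"
    using e by (intro order_tendstoD) auto
  then obtain a where a: "\<Omega> a * Lp_norm p f < e" by (auto simp: eventually_sequentially)
  show "\<exists>d>0. \<forall>s\<in>{0..1}. dist s t < d \<longrightarrow> dist (integral_operator K f s) (integral_operator K f t) < e"
  proof (intro exI[of _ "1 / 2 ^ a"] conjI ballI impI)
    fix s :: real assume "s \<in> {0..1}" "dist s t < 1 / 2 ^ a"
    then show "dist (integral_operator K f s) (integral_operator K f t) < e"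
      using operator_diff_le[OF _ t _ f, of s a] a by (simp add: dist_real_def)
  qed simp
qed

lemma operator_in_C01:
  assumes "f \<in> Lp p" shows "integral_operator K f \<in> mspace C01"
proof -
  have "continuous_map (top_of_set {0..1}) euclidean (integral_operator K f)"
    using operator_continuous[OF assms] by simp
  moreover have "compactin (top_of_set {0..1::real}) (topspace (top_of_set {0..1}))"
    by (simp add: compactin_subtopology)
  ultimately show ?thesis
    unfolding C01_def by (subst compactin_mspace_cfunspace) (auto simp: integral_operator_def)
qed

lemma C01_mdist_le:
  assumes "0 \<le> B" "\<And>t. t \<in> {0..1} \<Longrightarrow> \<bar>g t - h t\<bar> \<le> B"
  shows "mdist C01 g h \<le> B"
  unfolding C01_def using assms by (intro mdist_cfunspace_le) (auto simp: dist_real_def)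

lemma bounded_operator: "bounded_operator_Lp_C01 p K"
  unfolding bounded_operator_Lp_C01_def
proof (intro conjI ballI exI[of _ "\<Omega> 0"])
  fix f assume f: "f \<in> Lp p"
  show "mdist C01 (integral_operator K f) (\<lambda>t\<in>{0..1}. 0) \<le> \<Omega> 0 * Lp_norm p f"
    using operator_le[OF _ f] \<Omega>_pos[of 0] Lp_norm_nonneg[of p f] by (intro C01_mdist_le) auto
qed (auto intro!: pairing_integrable K_Lq operator_in_C01)

lemma zero_in_ball: "(\<lambda>x. 0) \<in> Lp_unit_ball p"
  using p_pos by (simp add: Lp_unit_ball_def Lp_zero Lp_norm_def)

text \<open>The image of one member of each code class serves as the centre of a ball, so that the centres
  lie in the range of the operator and are continuous.\<close>
lemma entropy_number_le_code:
  fixes code :: "(real \<Rightarrow> real) \<Rightarrow> 'c"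
  assumes fin: "finite C" and sub: "code ` Lp_unit_ball p \<subseteq> C" and card: "card C \<le> 2 ^ (n - 1)"
    and eps: "0 \<le> \<epsilon>"
    and close: "\<And>f g t. f \<in> Lp_unit_ball p \<Longrightarrow> g \<in> Lp_unit_ball p \<Longrightarrow> code f = code g \<Longrightarrow> t \<in> {0..1}
      \<Longrightarrow> \<bar>integral_operator K f t - integral_operator K g t\<bar> \<le> \<epsilon>"
  shows "operator_entropy_number p K n \<le> \<epsilon>"
proof -
  let ?B = "Lp_unit_ball p" and ?T = "integral_operator K"
  have B: "f \<in> Lp p" if "f \<in> ?B" for f using that by (simp add: Lp_unit_ball_def)
  define rep where "rep c = (if c \<in> code ` ?B then SOME f. f \<in> ?B \<and> code f = c else (\<lambda>x. 0))" for c
  have rep: "rep c \<in> ?B" for c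
    unfolding rep_def using zero_in_ball
    by (auto intro: someI2_ex[where Q = "\<lambda>f. f \<in> ?B"])
  have code_rep: "code (rep (code f)) = code f" if "f \<in> ?B" for f
  proof -
    have "\<exists>g. g \<in> ?B \<and> code g = code f" using that by blast
    then have "code (SOME g. g \<in> ?B \<and> code g = code f) = code f" by (rule someI2_ex) simp
    moreover have "rep (code f) = (SOME g. g \<in> ?B \<and> code g = code f)"
      using that unfolding rep_def by (simp only: imageI if_True)
    ultimately show ?thesis by simp
  qed
  obtain e where e: "bij_betw e {1..card C} C"
    using fin by (metis ex_bij_betw_nat_finite_1)
  define x where "x i = ?T (rep (e i))" for i
  have "?T ` ?B \<subseteq> (\<Union>i\<in>{1..2 ^ (n - 1)}. mcball_of C01 (x i) \<epsilon>)"
  proof (rule image_subsetI, unfold UN_iff)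
    fix f assume f: "f \<in> ?B"
    then obtain i where i: "i \<in> {1..card C}" "e i = code f"
      using e sub by (metis (no_types, lifting) bij_betw_imp_surj_on imageE image_eqI subsetD)
    have "mdist C01 (?T (rep (e i))) (?T f) \<le> \<epsilon>"
      using close[OF rep f] code_rep[OF f] i(2) eps by (intro C01_mdist_le) auto
    then show "\<exists>i\<in>{1..2 ^ (n - 1)}. ?T f \<in> mcball_of C01 (x i) \<epsilon>"
      using i card f by (intro bexI[of _ i]) (auto simp: x_def operator_in_C01 B rep)
  qed
  moreover have "\<forall>i\<in>{1..2 ^ (n - 1)}. x i \<in> mspace C01"
    by (simp add: x_def operator_in_C01 B rep)
  ultimately have "\<epsilon> \<in> {\<epsilon>. 0 \<le> \<epsilon> \<and> (\<exists>x. (\<forall>i\<in>{1..2 ^ (n - 1) :: nat}. x i \<in> mspace C01) \<and>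
      ?T ` ?B \<subseteq> (\<Union>i\<in>{1..2 ^ (n - 1)}. mcball_of C01 (x i) \<epsilon>))}"
    using eps by blast
  then show ?thesis
    unfolding operator_entropy_number_def entropy_number_def covering_radius_def
    by (rule cInf_lower) (auto intro: bdd_belowI[of _ 0])
qed

end

text \<open>Rounding down to a fine dyadic grid and then to a coarse one is rounding down to the coarse grid.
  Hence a grid point determines its ancestor, and a level needs only one functional per grid point,
  not one per pair of neighbouring grid points.\<close>
lemma nat_floor_dyadic_div:
  fixes t :: real
  assumes "a \<le> b" "0 \<le> t"
  shows "nat \<lfloor>t * 2 ^ b\<rfloor> div 2 ^ (b - a) = nat \<lfloor>t * 2 ^ a\<rfloor>"
proof -
  have "\<lfloor>t * 2 ^ b\<rfloor> div 2 ^ (b - a) = \<lfloor>t * 2 ^ b / real_of_int (2 ^ (b - a))\<rfloor>"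
    by (metis floor_divide_real_eq_div of_int_power zero_le_numeral zero_le_power)
  also have "t * 2 ^ b / real_of_int (2 ^ (b - a)) = t * 2 ^ a"
  proof -
    have "(2 :: real) ^ b = 2 ^ a * 2 ^ (b - a)" using assms(1) by (simp flip: power_add)
    then show ?thesis by simp
  qed
  finally show ?thesis
    by (metis assms(2) nat_div_distrib nat_power_eq mult_nonneg_nonneg zero_le_floor
        zero_le_numeral zero_le_power nat_numeral)
qed

context kernel_modulus begin

text \<open>Let \<open>D\<close> be the difference of the images of two functions with equal codes. Along the nested grids
  \<open>D t\<close> is the sum of the increments between consecutive roundings of \<open>t\<close>, each at most twice a
  tolerance, and of the increment from the finest grid to \<open>t\<close>. At the coarsest level the increment
  is the value itself, with norm at most \<open>\<Omega> 0\<close>.\<close>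
lemma chaining:
  fixes level :: "nat \<Rightarrow> nat" and w :: "nat \<Rightarrow> real"
  defines "prev \<equiv> \<lambda>l. if l = 0 then 0 else level (l - 1)"
  assumes mono: "mono level" and w: "\<And>l. 0 < w l" and x: "0 < x"
    and budget: "x + (\<Sum>l\<le>m. 2 * (2 ^ level l + 1) * bit_cost (w l)) \<le> real n - 1"
  shows "operator_entropy_number p K n
      \<le> 6 * (\<Sum>l\<le>m. \<Omega> (prev l) * (w l / x) powr (1 / p)) + 2 * \<Omega> (level m)"
proof -
  \<comment> \<open>An index consists of a level, a grid point of this level and a sign.\<close>
  define pt where "pt l u = real u / 2 ^ level l" for l u
  define inc where "inc l u = (if l = 0 then K (pt l u)
      else (\<lambda>t. K (pt l u) t - K (pt (l - 1) (u div 2 ^ (level l - level (l - 1)))) t))" for l u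
  define A where "A = (SIGMA l : {..m}. {..2 ^ level l :: nat} \<times> (UNIV :: bool set))"
  define sg :: "bool \<Rightarrow> real" where "sg b = (if b then 1 else -1)" for b
  define g where "g = (\<lambda>(l, u, b). \<lambda>t. sg b * inc l u t)"
  define r where "r = (\<lambda>(l, u :: nat, b :: bool). \<Omega> (prev l))"
  define wt where "wt = (\<lambda>(l, u :: nat, b :: bool). w l)"
  define \<epsilon> where "\<epsilon> l = 3 * \<Omega> (prev l) * (w l / x) powr (1 / p)" for l
  have finA: "finite A" by (simp add: A_def)
  have mono': "level (l - 1) \<le> level l" for l using mono by (auto intro: monoD)
  have pt: "pt l u \<in> {0..1}" if "u \<le> 2 ^ level l" for l and u :: nat
  proof -
    have "real u \<le> 2 ^ level l" using that by (metis of_nat_le_iff of_nat_numeral of_nat_power)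
    then show ?thesis by (simp add: pt_def)
  qed
  have parent: "u div 2 ^ (level l - level (l - 1)) \<le> 2 ^ level (l - 1)"
    if "u \<le> 2 ^ level l" for l and u :: nat
  proof -
    have "u div 2 ^ (level l - level (l - 1)) \<le> 2 ^ level l div 2 ^ (level l - level (l - 1))"
      using that by (rule div_le_mono)
    also have "2 ^ level l = (2 :: nat) ^ level (l - 1) * 2 ^ (level l - level (l - 1))"
      using mono'[of l] by (simp flip: power_add)
    also have "2 ^ level (l - 1) * 2 ^ (level l - level (l - 1)) div 2 ^ (level l - level (l - 1))
        = (2 :: nat) ^ level (l - 1)" by simp
    finally show ?thesis .
  qed
  have inc_Lq: "inc l u \<in> Lp q" and inc_norm: "Lp_norm q (inc l u) \<le> \<Omega> (prev l)"
    if u: "u \<le> 2 ^ level l" for l and u :: nat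
  proof -
    show "inc l u \<in> Lp q"
    proof (cases "l = 0")
      case True
      then show ?thesis using K_Lq[OF pt[OF u]] by (simp add: inc_def)
    next
      case False
      then show ?thesis
        unfolding inc_def if_not_P[OF False] by (intro Lp_diff K_Lq q_pos pt u parent)
    qed
    show "Lp_norm q (inc l u) \<le> \<Omega> (prev l)"
    proof (cases "l = 0")
      case True
      then show ?thesis using norm_K[OF pt[OF u]] unfolding inc_def prev_def by (simp only: if_True refl)
    next
      case False
      let ?d = "level l - level (l - 1)"
      have "real (u div 2 ^ ?d) = real_of_int \<lfloor>real u / 2 ^ ?d\<rfloor>"
        using floor_divide_of_nat_eq[where ?'a = real, of u "2 ^ ?d"] by simp
      then have "\<bar>real u / 2 ^ ?d - real (u div 2 ^ ?d)\<bar> \<le> 1" by linarith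
      then have "\<bar>real u / 2 ^ ?d - real (u div 2 ^ ?d)\<bar> / 2 ^ level (l - 1) \<le> 1 / 2 ^ level (l - 1)"
        by (intro divide_right_mono) auto
      moreover have "(2::real) ^ level l = 2 ^ ?d * 2 ^ level (l - 1)"
        using mono'[of l] by (simp flip: power_add)
      then have "pt l u - pt (l - 1) (u div 2 ^ ?d)
          = (real u / 2 ^ ?d - real (u div 2 ^ ?d)) / 2 ^ level (l - 1)"
        by (simp add: pt_def diff_divide_distrib)
      ultimately have "\<bar>pt l u - pt (l - 1) (u div 2 ^ ?d)\<bar> \<le> 1 / 2 ^ level (l - 1)"
        by (simp add: abs_divide)
      then show ?thesis
        using modulus[OF pt[OF u] pt[OF parent[OF u]]] False unfolding inc_def prev_def by (simp only: if_False)
    qed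
  qed
  have gL: "g a \<in> Lp q" if "a \<in> A" for a
    using that by (auto simp: A_def g_def intro!: Lp_cmult inc_Lq)
  have gn: "Lp_norm q (g a) \<le> r a" if "a \<in> A" for a
  proof -
    have "\<bar>sg b\<bar> = 1" for b by (simp add: sg_def)
    with that show ?thesis
      by (auto simp: A_def g_def r_def Lp_norm_cmult[OF q_pos] intro!: inc_norm)
  qed
  have rp: "0 < r a" and wp: "0 < wt a" for a
    by (auto simp: r_def wt_def \<Omega>_pos w split: prod.split)
  define C where "C = {\<nu> \<in> A \<rightarrow>\<^sub>E (UNIV :: nat set). (\<Sum>a\<in>A. wt a * real (\<nu> a)) \<le> x}"
  define good where "good f \<nu> \<longleftrightarrow> \<nu> \<in> C \<and>
    (\<forall>a\<in>A. (\<integral>t. g a t * (f t - decode A g r wt x \<nu> t) \<partial>\<mu>) \<le> 3 * r a * (wt a / x) powr (1 / p))" for f \<nu>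
  define code where "code f = (SOME \<nu>. good f \<nu>)" for f
  have code: "good f (code f)" if "f \<in> Lp_unit_ball p" for f
  proof -
    have "\<exists>\<nu>. good f \<nu>"
      by (rule greedy_code[of A g r wt x f])
        (use finA gL gn rp wp x that in \<open>auto simp: good_def C_def\<close>)
    then show ?thesis unfolding code_def by (rule someI_ex)
  qed
  have card_eq: "(\<Sum>a\<in>A. bit_cost (wt a)) = (\<Sum>l\<le>m. 2 * (2 ^ level l + 1) * bit_cost (w l))"
  proof -
    have "(\<Sum>a\<in>A. bit_cost (wt a)) = (\<Sum>(l, v)\<in>A. bit_cost (w l))"
      by (intro sum.cong) (auto simp: wt_def)
    also have "\<dots> = (\<Sum>l\<le>m. \<Sum>v\<in>{..2 ^ level l :: nat} \<times> (UNIV :: bool set). bit_cost (w l))"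
      unfolding A_def by (rule sum.Sigma[symmetric]) auto
    finally show ?thesis by (simp add: card_cartesian_product algebra_simps)
  qed
  have "real (card C) \<le> 2 powr (x + (\<Sum>a\<in>A. bit_cost (wt a)))"
    unfolding C_def by (intro card_weighted_counts finA wp)
  also have "\<dots> \<le> 2 powr (real n - 1)"
    unfolding card_eq using budget by (intro powr_mono) auto
  finally have cardC: "real (card C) \<le> 2 powr (real n - 1)" .
  have "0 < n"
  proof (rule ccontr)
    assume "\<not> 0 < n"
    moreover have "0 \<le> bit_cost (w l)" for l
      using w[of l] by (simp add: bit_cost_def powr_less_one)
    then have "0 \<le> (\<Sum>l\<le>m. 2 * (2 ^ level l + 1) * bit_cost (w l))" by (intro sum_nonneg) auto
    ultimately show False using budget x by simp
  qed
  then have "real (card C) \<le> 2 ^ (n - 1)"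
    using cardC by (simp add: of_nat_diff flip: powr_realpow)
  then have card_le: "card C \<le> 2 ^ (n - 1)"
    by (metis of_nat_le_iff of_nat_numeral of_nat_power)
  show ?thesis
  proof (rule entropy_number_le_code[of C code])
    show "finite C" unfolding C_def by (intro card_weighted_counts finA wp)
    show "code ` Lp_unit_ball p \<subseteq> C" using code by (auto simp: good_def)
    show "card C \<le> 2 ^ (n - 1)" by (rule card_le)
    show "0 \<le> 6 * (\<Sum>l\<le>m. \<Omega> (prev l) * (w l / x) powr (1 / p)) + 2 * \<Omega> (level m)"
      using \<Omega>_pos by (auto intro!: sum_nonneg add_nonneg_nonneg mult_nonneg_nonneg simp: less_imp_le)
    fix f f' t assume f: "f \<in> Lp_unit_ball p" and f': "f' \<in> Lp_unit_ball p"
      and same: "code f = code f'" and t: "t \<in> {0..1::real}"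
    let ?T = "integral_operator K" and ?h = "decode A g r wt x (code f)"
    have fL: "f \<in> Lp p" "f' \<in> Lp p" and fn: "Lp_norm p f \<le> 1" "Lp_norm p f' \<le> 1"
      using f f' by (auto simp: Lp_unit_ball_def)
    have hL: "?h \<in> Lp p" by (intro decode_Lp gL)
    have inc_le: "\<bar>(\<integral>s. inc l u s * f s \<partial>\<mu>) - (\<integral>s. inc l u s * f' s \<partial>\<mu>)\<bar> \<le> 2 * \<epsilon> l"
      if l: "l \<le> m" and u: "u \<le> 2 ^ level l" for l and u :: nat
    proof -
      have *: "\<bar>(\<integral>s. inc l u s * f0 s \<partial>\<mu>) - (\<integral>s. inc l u s * ?h s \<partial>\<mu>)\<bar> \<le> \<epsilon> l"
        if f0: "f0 \<in> Lp_unit_ball p" and c: "code f0 = code f" for f0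
      proof -
        have f0L: "f0 \<in> Lp p" using f0 by (simp add: Lp_unit_ball_def)
        have 1: "(\<integral>s. g (l, u, b) s * (f0 s - ?h s) \<partial>\<mu>) \<le> \<epsilon> l" for b
          using code[OF f0] l u unfolding good_def c
          by (auto simp: A_def r_def wt_def \<epsilon>_def dest!: bspec[of _ _ "(l, u, b)"])
        have 2: "(\<integral>s. inc l u s * (f0 s - ?h s) \<partial>\<mu>) = (\<integral>s. inc l u s * f0 s \<partial>\<mu>) - (\<integral>s. inc l u s * ?h s \<partial>\<mu>)"
          unfolding right_diff_distrib
          by (intro Bochner_Integration.integral_diff pairing_integrable inc_Lq u f0L hL)
        have "g (l, u, b) = (\<lambda>s. sg b * inc l u s)" for b by (simp add: g_def)
        then have "sg b * (\<integral>s. inc l u s * (f0 s - ?h s) \<partial>\<mu>) \<le> \<epsilon> l" for b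
          using 1[of b] by (simp add: mult.assoc)
        from this[of True] this[of False] show ?thesis by (simp add: sg_def 2)
      qed
      show ?thesis using *[OF f refl] *[OF f' same[symmetric]] by linarith
    qed
    define \<nu> where "\<nu> l = nat \<lfloor>t * 2 ^ level l\<rfloor>" for l
    have \<nu>_le: "\<nu> l \<le> 2 ^ level l" for l
    proof -
      have "t * 2 ^ level l \<le> 2 ^ level l" using t by simp
      then have "\<lfloor>t * 2 ^ level l\<rfloor> \<le> \<lfloor>(2 :: real) ^ level l\<rfloor>" by (rule floor_mono)
      also have "\<dots> = 2 ^ level l" by (metis floor_of_int of_int_numeral of_int_power)
      finally have "\<lfloor>t * 2 ^ level l\<rfloor> \<le> 2 ^ level l" .
      then show ?thesis unfolding \<nu>_def by (simp add: nat_le_iff)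
    qed
    define D where "D s = ?T f s - ?T f' s" for s
    have step: "\<bar>D (pt l (\<nu> l)) - (if l = 0 then 0 else D (pt (l - 1) (\<nu> (l - 1))))\<bar> \<le> 2 * \<epsilon> l"
      if "l \<le> m" for l
    proof -
      have "\<nu> l div 2 ^ (level l - level (l - 1)) = \<nu> (l - 1)"
        unfolding \<nu>_def using t by (intro nat_floor_dyadic_div mono') auto
      note child = this
      have "(\<integral>s. inc l (\<nu> l) s * f0 s \<partial>\<mu>)
          = ?T f0 (pt l (\<nu> l)) - (if l = 0 then 0 else ?T f0 (pt (l - 1) (\<nu> (l - 1))))"
        if "f0 \<in> Lp p" for f0
      proof (cases "l = 0")
        case True
        then show ?thesis using operator_apply[OF pt[OF \<nu>_le]] by (simp add: inc_def)
      next
        case False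
        show ?thesis
          unfolding inc_def child if_not_P[OF False]
          by (rule operator_diff[OF pt[OF \<nu>_le] pt[OF \<nu>_le] that, symmetric])
      qed
      then have "D (pt l (\<nu> l)) - (if l = 0 then 0 else D (pt (l - 1) (\<nu> (l - 1))))
          = (\<integral>s. inc l (\<nu> l) s * f s \<partial>\<mu>) - (\<integral>s. inc l (\<nu> l) s * f' s \<partial>\<mu>)"
        using fL by (simp add: D_def)
      then show ?thesis using inc_le[OF that \<nu>_le] by simp
    qed
    have chain: "\<bar>D (pt k (\<nu> k))\<bar> \<le> (\<Sum>l\<le>k. 2 * \<epsilon> l)" if "k \<le> m" for k
      using that
    proof (induction k)
      case 0 then show ?case using step[of 0] by simp
    next
      case (Suc k)
      then show ?case using step[of "Suc k"] by simp
    qed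
    have near: "\<bar>t - pt m (\<nu> m)\<bar> \<le> 1 / 2 ^ level m"
    proof -
      have "real (\<nu> m) = real_of_int \<lfloor>t * 2 ^ level m\<rfloor>" using t by (simp add: \<nu>_def)
      then have "\<bar>t * 2 ^ level m - real (\<nu> m)\<bar> / 2 ^ level m \<le> 1 / 2 ^ level m"
        by (intro divide_right_mono) (linarith, simp)
      moreover have "t - pt m (\<nu> m) = (t * 2 ^ level m - real (\<nu> m)) / 2 ^ level m"
        by (simp add: pt_def diff_divide_distrib)
      ultimately show ?thesis by (simp add: abs_divide)
    qed
    have tail: "\<bar>?T f0 t - ?T f0 (pt m (\<nu> m))\<bar> \<le> \<Omega> (level m)" if "f0 \<in> Lp p" "Lp_norm p f0 \<le> 1" for f0
      using operator_diff_le[OF t pt[OF \<nu>_le] near that(1)] that(2) \<Omega>_pos[of "level m"]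
      by (smt (verit) mult_left_le)
    have "\<bar>D t\<bar> \<le> \<bar>D (pt m (\<nu> m))\<bar> + 2 * \<Omega> (level m)"
      using tail[OF fL(1) fn(1)] tail[OF fL(2) fn(2)] unfolding D_def by linarith
    also have "\<dots> \<le> (\<Sum>l\<le>m. 2 * \<epsilon> l) + 2 * \<Omega> (level m)" using chain[of m] by simp
    also have "(\<Sum>l\<le>m. 2 * \<epsilon> l) = 6 * (\<Sum>l\<le>m. \<Omega> (prev l) * (w l / x) powr (1 / p))"
      by (simp add: \<epsilon>_def sum_distrib_left mult.assoc)
    finally show "\<bar>?T f t - ?T f' t\<bar> \<le> 6 * (\<Sum>l\<le>m. \<Omega> (prev l) * (w l / x) powr (1 / p)) + 2 * \<Omega> (level m)"
      by (simp add: D_def)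
  qed
qed

end

section \<open>The modulus of continuity of a singular convolution kernel\<close>

lemma powr_superadditive:
  fixes a b s :: real
  assumes "0 \<le> a" "0 \<le> b" "1 \<le> s"
  shows "a powr s + b powr s \<le> (a + b) powr s"
proof -
  have *: "x powr s \<le> x * (a + b) powr (s - 1)" if "0 \<le> x" "x \<le> a + b" for x
  proof (cases "x = 0")
    case False
    with that have "x powr s = x * x powr (s - 1)" by (simp add: powr_diff)
    also have "\<dots> \<le> x * (a + b) powr (s - 1)"
      using that assms by (intro mult_left_mono powr_mono2) auto
    finally show ?thesis .
  qed simp
  have "a powr s + b powr s \<le> a * (a + b) powr (s - 1) + b * (a + b) powr (s - 1)"
    using *[of a] *[of b] assms by simp
  also have "\<dots> = (a + b) * (a + b) powr (s - 1)" by (rule distrib_right[symmetric])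
  also have "\<dots> = (a + b) powr s"
    using assms by (cases "a + b = 0") (simp_all add: powr_diff)
  finally show ?thesis .
qed

text \<open>This turns an integral of \<open>|k u - k v|\<^sup>q\<close> into a telescoping difference of integrals of
  \<open>k\<^sup>q\<close>.\<close>
lemma abs_diff_powr_le:
  fixes a b s :: real
  assumes "0 \<le> a" "0 \<le> b" "1 \<le> s"
  shows "\<bar>a - b\<bar> powr s \<le> \<bar>a powr s - b powr s\<bar>"
proof (cases "b \<le> a")
  case True
  then show ?thesis using powr_superadditive[of "a - b" b s] assms by simp
next
  case False
  then show ?thesis using powr_superadditive[of "b - a" a s] assms by simp
qed

lemma has_integral_reflect_unit:
  fixes G :: "real \<Rightarrow> real"
  assumes "(G has_integral J) {0..1}"
  shows "((\<lambda>x. G (1 - x)) has_integral J) {0..1}"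
proof -
  have "(\<lambda>x. 1 - x) ` {0..1::real} = {0..1}"
    by (auto simp: image_iff intro!: bexI[of _ "1 - x" for x])
  then show ?thesis
    using has_integral_affinity[of G J 0 1 "-1" 1] assms by (simp add: add.commute)
qed

lemma integrable_le_has_integral:
  fixes h G :: "real \<Rightarrow> real"
  assumes h: "h \<in> borel_measurable \<mu>" and G: "(G has_integral J) {0..1}"
    and le: "\<And>x. x \<in> {0..1} \<Longrightarrow> 0 \<le> h x \<and> h x \<le> G x"
  shows "integrable \<mu> h" "(\<integral>x. h x \<partial>\<mu>) \<le> J"
proof -
  have "G absolutely_integrable_on {0..1}"
    using G le by (intro nonnegative_absolutely_integrable_1) (auto intro: order.trans simp: integrable_on_def)
  then have GI: "integrable \<mu> G" by (intro absolutely_integrable_imp_integrable) auto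
  show hI: "integrable \<mu> h"
    by (rule Bochner_Integration.integrable_bound[OF GI h]) (use le in \<open>auto intro!: AE_I2 order.trans[OF _ abs_ge_self]\<close>)
  have "(\<integral>x. h x \<partial>\<mu>) \<le> (\<integral>x. G x \<partial>\<mu>)"
    using le by (intro integral_mono hI GI) auto
  also have "\<dots> = J"
    using has_integral_integral_lebesgue_on[OF GI] G by (auto intro: has_integral_unique)
  finally show "(\<integral>x. h x \<partial>\<mu>) \<le> J" .
qed

text \<open>A profile that is singular only at the origin. For decreasing \<open>k\<close> the constant \<open>M\<close> can be zero. The
  logarithmic profile increases near \<open>1\<close> when \<open>c\<^sub>0\<close> is small, and the one-sided Lipschitz bound for
  \<open>k\<^sup>q\<close> measures how much.\<close>
locale singular_profile = conjugate_exponents +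
  fixes k :: "real \<Rightarrow> real" and \<Psi> :: "real \<Rightarrow> real" and M :: real
  assumes k_measurable [measurable]: "k \<in> borel_measurable borel"
    and k_nonneg: "\<And>x. 0 \<le> k x" and k_0: "k 0 = 0"
    and k_integral: "\<And>\<delta>. 0 \<le> \<delta> \<Longrightarrow> \<delta> \<le> 1 \<Longrightarrow> ((\<lambda>x. k x powr q) has_integral \<Psi> \<delta>) {0..\<delta>}"
    and M_nonneg: "0 \<le> M"
    and k_increase: "\<And>u v. 0 < u \<Longrightarrow> u \<le> v \<Longrightarrow> v \<le> 1 \<Longrightarrow> k v powr q - k u powr q \<le> M * (v - u)"
begin

abbreviation V :: "real \<Rightarrow> real \<Rightarrow> real" where "V \<equiv> VO_kernel k"

lemma V_nonneg: "0 \<le> V t x"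
  by (simp add: VO_kernel_def k_nonneg)

lemma \<Psi>_mono: "0 \<le> \<delta> \<Longrightarrow> \<delta> \<le> \<delta>' \<Longrightarrow> \<delta>' \<le> 1 \<Longrightarrow> \<Psi> \<delta> \<le> \<Psi> \<delta>'"
  by (rule has_integral_subset_le[OF _ k_integral k_integral]) auto

lemma \<Psi>_nonneg: "0 \<le> \<delta> \<Longrightarrow> \<delta> \<le> 1 \<Longrightarrow> 0 \<le> \<Psi> \<delta>"
  by (rule has_integral_nonneg[OF k_integral]) auto

lemma V_tail_integral:
  assumes "0 \<le> \<delta>" "\<delta> \<le> t" "t \<le> 1"
  shows "((\<lambda>x. if t - \<delta> \<le> x then V t x powr q else 0) has_integral \<Psi> \<delta>) {0..1}"
proof -
  have img: "(\<lambda>x. t - x) ` {0..\<delta>} = {t - \<delta>..t}"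
    by (auto simp: image_iff intro!: bexI[of _ "t - x" for x])
  have "((\<lambda>x. k (t - x) powr q) has_integral \<Psi> \<delta>) {t - \<delta>..t}"
    using has_integral_affinity[of "\<lambda>x. k x powr q" "\<Psi> \<delta>" 0 \<delta> "-1" t] k_integral assms
    by (simp add: img)
  then have "((\<lambda>x. if x \<in> {t - \<delta>..t} then k (t - x) powr q else 0) has_integral \<Psi> \<delta>) {0..1}"
    using assms by (subst has_integral_restrict) auto
  moreover have "(if x \<in> {t - \<delta>..t} then k (t - x) powr q else 0)
      = (if t - \<delta> \<le> x then V t x powr q else 0)" for x
    using k_0 by (cases "x = t") (auto simp: VO_kernel_def)
  ultimately show ?thesis by simp
qed

lemma V_integral:
  assumes "t \<in> {0..1}"
  shows "((\<lambda>x. V t x powr q) has_integral \<Psi> t) {0..1}"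
  using has_integral_eq[OF _ V_tail_integral[of t t]] assms by auto

text \<open>Where both kernels are present, \<open>|V t - V s|\<^sup>q\<close> is at most \<open>V s\<^sup>q - V t\<^sup>q\<close> up to the increase of
  \<open>k\<^sup>q\<close>; on the strip \<open>s \<le> x < t\<close> only \<open>V t\<close> is present. Integration gives
  \<open>\<Psi> s - \<Psi> t \<le> 0\<close> and two contributions \<open>\<Psi> (t - s)\<close> of the strip.\<close>
lemma V_difference_aux:
  assumes s: "0 \<le> s" and st: "s \<le> t" and t: "t \<le> 1"
  shows "\<exists>G J. (G has_integral J) {0..1} \<and> J \<le> 2 * (\<Psi> (t - s) + M * (t - s)) \<and>
    (\<forall>x\<in>{0..1}. \<bar>V t x - V s x\<bar> powr q \<le> G x)"
proof -
  define c where "c = 2 * M * (t - s)"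
  define G where "G x = V s x powr q - V t x powr q + c
      + 2 * (if t - (t - s) \<le> x then V t x powr q else 0)" for x
  have "(G has_integral \<Psi> s - \<Psi> t + c + 2 * \<Psi> (t - s)) {0..1}"
    unfolding G_def
    using s st t has_integral_const_real[of c 0 1]
    by (intro has_integral_add has_integral_diff has_integral_mult_right V_integral V_tail_integral) auto
  moreover have "\<bar>V t x - V s x\<bar> powr q \<le> G x" if x: "x \<in> {0..1}" for x
  proof (cases "x < s")
    case True
    have q1: "1 \<le> q" using q_gt_1 by simp
    have "\<bar>V t x - V s x\<bar> powr q \<le> \<bar>V s x powr q - V t x powr q\<bar>"
      using abs_diff_powr_le[OF V_nonneg V_nonneg q1, of t x s x] by (simp add: abs_minus_commute)
    also have "\<dots> \<le> V s x powr q - V t x powr q + c"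
    proof -
      have "V t x powr q - V s x powr q \<le> M * (t - s)"
        using k_increase[of "s - x" "t - x"] True st t x by (simp add: VO_kernel_def)
      moreover have "0 \<le> M * (t - s)" using M_nonneg st by simp
      ultimately show ?thesis unfolding c_def by linarith
    qed
    finally show ?thesis using True by (simp add: G_def)
  next
    case False
    then have "V s x = 0" by (simp add: VO_kernel_def)
    then show ?thesis using False V_nonneg[of t x] M_nonneg st by (simp add: G_def c_def)
  qed
  moreover have "\<Psi> s \<le> \<Psi> t" using s st t by (rule \<Psi>_mono)
  ultimately show ?thesis by (intro exI[of _ G] exI conjI) (auto simp: c_def algebra_simps)
qed

lemma V_difference:
  assumes "s \<in> {0..1}" "t \<in> {0..1}"
  obtains G J where "(G has_integral J) {0..1}" "J \<le> 2 * (\<Psi> \<bar>s - t\<bar> + M * \<bar>s - t\<bar>)"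
    "\<And>x. x \<in> {0..1} \<Longrightarrow> \<bar>V s x - V t x\<bar> powr q \<le> G x"
proof (cases "s \<le> t")
  case True
  then show ?thesis
    using V_difference_aux[of s t] assms that by (auto simp: abs_minus_commute)
next
  case False
  then show ?thesis
    using V_difference_aux[of t s] assms that by auto
qed

text \<open>The two-sided kernel is a one-sided kernel plus its reflection. On the diagonal this relies on
  \<open>k 0 = 0\<close>.\<close>
lemma WS_eq_V:
  assumes "t \<in> {0..1}" "x \<in> {0..1}"
  shows "WS_kernel k t x = V t x + V (1 - t) (1 - x)"
  using k_0 by (cases t x rule: linorder_cases) (auto simp: WS_kernel_def VO_kernel_def)

lemma kernel_measurable:
  assumes "K \<in> {WS_kernel k, VO_kernel k}"
  shows "K t \<in> borel_measurable \<mu>"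
proof -
  have "K t \<in> borel_measurable borel"
    using assms by (auto simp: WS_kernel_def[abs_def] VO_kernel_def[abs_def])
  then show ?thesis
    by (intro measurable_restrict_space1 measurable_completion) simp
qed

lemma sum_powr_q_le:
  assumes "\<bar>a\<bar> powr q \<le> A" "\<bar>b\<bar> powr q \<le> B"
  shows "\<bar>a + b\<bar> powr q \<le> 4 * (A + B)"
proof -
  have "2 powr q \<le> 2 powr (2 :: real)" using q_le_2 by (intro powr_mono) auto
  then have "2 powr q \<le> 4" by simp
  then have "2 powr q * (\<bar>a\<bar> powr q + \<bar>b\<bar> powr q) \<le> 4 * (A + B)"
    using assms by (intro mult_mono) auto
  then show ?thesis using powr_abs_add_le[OF q_pos, of a b] by linarith
qed

lemma kernel_Lq:
  assumes K: "K \<in> {WS_kernel k, VO_kernel k}" and t: "t \<in> {0..1}"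
  shows "K t \<in> Lp q" "(\<integral>x. \<bar>K t x\<bar> powr q \<partial>\<mu>) \<le> 16 * \<Psi> 1"
proof -
  define G where "G x = 4 * (V t x powr q + V (1 - t) (1 - x) powr q)" for x
  have G: "(G has_integral 4 * (\<Psi> t + \<Psi> (1 - t))) {0..1}"
    unfolding G_def using t
    by (intro has_integral_mult_right has_integral_add V_integral has_integral_reflect_unit[OF V_integral]) auto
  have le: "0 \<le> \<bar>K t x\<bar> powr q \<and> \<bar>K t x\<bar> powr q \<le> G x" if x: "x \<in> {0..1}" for x
  proof (cases "K = VO_kernel k")
    case True
    then show ?thesis using V_nonneg[of t x] by (simp add: G_def)
  next
    case False
    then have "K t x = V t x + V (1 - t) (1 - x)" using K WS_eq_V[OF t x] by auto
    then show ?thesis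
      using sum_powr_q_le[OF order.refl order.refl, of "V t x" "V (1 - t) (1 - x)"] V_nonneg
      by (simp add: G_def)
  qed
  note [measurable] = kernel_measurable[OF K]
  have meas: "(\<lambda>x. \<bar>K t x\<bar> powr q) \<in> borel_measurable \<mu>" by measurable
  have "integrable \<mu> (\<lambda>x. \<bar>K t x\<bar> powr q)" by (rule integrable_le_has_integral(1)[OF meas G le])
  then show "K t \<in> Lp q" by (simp add: Lp_def)
  have "(\<integral>x. \<bar>K t x\<bar> powr q \<partial>\<mu>) \<le> 4 * (\<Psi> t + \<Psi> (1 - t))"
    by (rule integrable_le_has_integral(2)[OF meas G le])
  moreover have "\<Psi> t \<le> \<Psi> 1" "\<Psi> (1 - t) \<le> \<Psi> 1" using t by (auto intro: \<Psi>_mono)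
  ultimately show "(\<integral>x. \<bar>K t x\<bar> powr q \<partial>\<mu>) \<le> 16 * \<Psi> 1" using \<Psi>_nonneg[of 1] by simp
qed

lemma kernel_difference:
  assumes K: "K \<in> {WS_kernel k, VO_kernel k}" and s: "s \<in> {0..1}" and t: "t \<in> {0..1}"
  shows "(\<integral>x. \<bar>K s x - K t x\<bar> powr q \<partial>\<mu>) \<le> 16 * (\<Psi> \<bar>s - t\<bar> + M * \<bar>s - t\<bar>)"
proof -
  let ?\<delta> = "\<bar>s - t\<bar>"
  obtain G J where G: "(G has_integral J) {0..1}" "J \<le> 2 * (\<Psi> ?\<delta> + M * ?\<delta>)"
    "\<And>x. x \<in> {0..1} \<Longrightarrow> \<bar>V s x - V t x\<bar> powr q \<le> G x"
    using V_difference[OF s t] by metis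
  obtain H I where H: "(H has_integral I) {0..1}" "I \<le> 2 * (\<Psi> ?\<delta> + M * ?\<delta>)"
    "\<And>x. x \<in> {0..1} \<Longrightarrow> \<bar>V (1 - s) x - V (1 - t) x\<bar> powr q \<le> H x"
    using V_difference[of "1 - s" "1 - t"] s t by (auto simp: abs_minus_commute)
  have GH: "((\<lambda>x. 4 * (G x + H (1 - x))) has_integral 4 * (J + I)) {0..1}"
    by (intro has_integral_mult_right has_integral_add G has_integral_reflect_unit H)
  have le: "0 \<le> \<bar>K s x - K t x\<bar> powr q \<and> \<bar>K s x - K t x\<bar> powr q \<le> 4 * (G x + H (1 - x))"
    if x: "x \<in> {0..1}" for x
  proof -
    have 1: "\<bar>V s x - V t x\<bar> powr q \<le> G x" by (rule G(3)[OF x])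
    have 2: "\<bar>V (1 - s) (1 - x) - V (1 - t) (1 - x)\<bar> powr q \<le> H (1 - x)"
      using x by (intro H(3)) auto
    have pos: "0 \<le> G x" "0 \<le> H (1 - x)" using order.trans[OF powr_ge_zero 1] order.trans[OF powr_ge_zero 2] .
    show ?thesis
    proof (cases "K = VO_kernel k")
      case True
      then show ?thesis using 1 pos by simp
    next
      case False
      then have "K s x - K t x = (V s x - V t x) + (V (1 - s) (1 - x) - V (1 - t) (1 - x))"
        using K WS_eq_V[OF s x] WS_eq_V[OF t x] by auto
      then show ?thesis using sum_powr_q_le[OF 1 2] by simp
    qed
  qed
  note [measurable] = kernel_measurable[OF K]
  have "(\<lambda>x. \<bar>K s x - K t x\<bar> powr q) \<in> borel_measurable \<mu>" by measurable
  then have "(\<integral>x. \<bar>K s x - K t x\<bar> powr q \<partial>\<mu>) \<le> 4 * (J + I)"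
    by (rule integrable_le_has_integral(2)[OF _ GH le])
  also have "4 * (J + I) \<le> 16 * (\<Psi> ?\<delta> + M * ?\<delta>)" using G(2) H(2) by argo
  finally show ?thesis .
qed

lemma kernel_modulusI:
  assumes K: "K \<in> {WS_kernel k, VO_kernel k}"
    and \<Omega>: "\<And>a. 0 < \<Omega> a" "\<Omega> \<longlonglongrightarrow> 0"
      "\<And>a. 16 * (\<Psi> (1 / 2 ^ a) + M * (1 / 2 ^ a)) \<le> \<Omega> a powr q"
  shows "kernel_modulus p q K \<Omega>"
proof (unfold_locales)
  fix t :: real assume t: "t \<in> {0..1}"
  show "K t \<in> Lp q" by (rule kernel_Lq(1)[OF K t])
  show "Lp_norm q (K t) \<le> \<Omega> 0"
    using kernel_Lq(2)[OF K t] \<Omega>(1)[of 0] \<Omega>(3)[of 0] M_nonneg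
    by (intro Lp_norm_le q_pos) (auto simp: algebra_simps)
next
  fix t s :: real and a :: nat
  assume s: "s \<in> {0..1}" and t: "t \<in> {0..1}" and d: "\<bar>s - t\<bar> \<le> 1 / 2 ^ a"
  have "\<Psi> \<bar>s - t\<bar> \<le> \<Psi> (1 / 2 ^ a)" using d by (intro \<Psi>_mono) auto
  moreover have "M * \<bar>s - t\<bar> \<le> M * (1 / 2 ^ a)" using d M_nonneg by (intro mult_left_mono)
  ultimately show "Lp_norm q (\<lambda>x. K s x - K t x) \<le> \<Omega> a"
    using kernel_difference[OF K s t] \<Omega>(1)[of a] \<Omega>(3)[of a]
    by (intro Lp_norm_le q_pos) (linarith | simp add: less_imp_le)+
qed (rule \<Omega>)+

end

section \<open>Entropy numbers under a polynomial modulus\<close>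

lemma dominated_by_eventually:
  assumes y: "\<And>n. 1 \<le> n \<Longrightarrow> 0 < y n" and le: "\<And>n. N \<le> n \<Longrightarrow> x n \<le> c * y n"
  shows "x \<preceq> y"
  unfolding dominated_by_def
proof (intro exI[of _ "\<bar>c\<bar> + 1 + (\<Sum>n=1..N. \<bar>x n\<bar> / y n)"] conjI allI impI)
  have nonneg: "0 \<le> (\<Sum>n=1..N. \<bar>x n\<bar> / y n)"
    using y by (intro sum_nonneg) (auto intro!: divide_nonneg_pos)
  then show "0 < \<bar>c\<bar> + 1 + (\<Sum>n=1..N. \<bar>x n\<bar> / y n)" by linarith
  fix n :: nat assume n: "1 \<le> n"
  show "x n \<le> (\<bar>c\<bar> + 1 + (\<Sum>n=1..N. \<bar>x n\<bar> / y n)) * y n"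
  proof (cases "N \<le> n")
    case True
    have "c * y n \<le> (\<bar>c\<bar> + 1 + (\<Sum>n=1..N. \<bar>x n\<bar> / y n)) * y n"
      using nonneg y[OF n] by (intro mult_right_mono) auto
    then show ?thesis using le[OF True] by linarith
  next
    case False
    have "\<bar>x n\<bar> / y n \<le> (\<Sum>n=1..N. \<bar>x n\<bar> / y n)"
      using False n y by (intro member_le_sum) (auto intro!: divide_nonneg_pos)
    then have "(\<bar>x n\<bar> / y n) * y n \<le> (\<bar>c\<bar> + 1 + (\<Sum>n=1..N. \<bar>x n\<bar> / y n)) * y n"
      using y[OF n] by (intro mult_right_mono) auto
    then show ?thesis using y[OF n] by simp
  qed
qed

lemma ex_power_between:
  fixes b y :: real
  assumes "1 < b" "1 \<le> y"
  obtains L :: nat where "b ^ L \<le> y" "y < b ^ (L + 1)"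
proof -
  define L where "L = nat \<lfloor>log b y\<rfloor>"
  have "0 \<le> log b y" using assms by simp
  then have "real L \<le> log b y" "log b y < real (L + 1)" unfolding L_def by linarith+
  then have "b powr real L \<le> y" "y < b powr real (L + 1)"
    using assms by (simp_all only: le_log_iff log_less_iff)
  then show ?thesis using assms by (intro that[of L]) (simp_all only: powr_realpow)
qed

text \<open>Sums over all levels split at a distinguished level \<open>L\<close> and are bounded by two series that depend
  only on the distance from \<open>L\<close>.\<close>
lemma sum_two_sided_le:
  fixes f g :: "nat \<Rightarrow> real"
  assumes f: "summable f" "\<And>d. 0 \<le> f d" and g: "summable g" "\<And>d. 0 \<le> g d"
  shows "(\<Sum>l\<le>m. if l \<le> L then f (L - l) else g (l - L)) \<le> suminf f + suminf g"
proof -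
  let ?A = "{l. l \<le> m \<and> l \<le> L}" and ?B = "{l. l \<le> m \<and> L < l}"
  have "(\<Sum>l\<le>m. if l \<le> L then f (L - l) else g (l - L))
      = (\<Sum>l\<in>?A. f (L - l)) + (\<Sum>l\<in>?B. g (l - L))"
  proof -
    have "{..m} = ?A \<union> ?B" by auto
    then show ?thesis
      by (simp add: sum.union_disjoint[of ?A ?B] disjoint_iff)
  qed
  also have "(\<Sum>l\<in>?A. f (L - l)) = (\<Sum>d\<in>(\<lambda>l. L - l) ` ?A. f d)"
    by (intro sum.reindex_cong[symmetric, where l = "\<lambda>l. L - l"]) (auto simp: inj_on_def)
  also have "\<dots> \<le> suminf f" by (intro sum_le_suminf f) auto
  also have "(\<Sum>l\<in>?B. g (l - L)) = (\<Sum>d\<in>(\<lambda>l. l - L) ` ?B. g d)"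
    by (intro sum.reindex_cong[symmetric, where l = "\<lambda>l. l - L"]) (auto simp: inj_on_def)
  also have "\<dots> \<le> suminf g" by (intro sum_le_suminf g) auto
  finally show ?thesis by simp
qed

lemma summable_linear_geometric:
  fixes a b \<alpha> :: real
  assumes "0 < \<alpha>"
  shows "summable (\<lambda>d. 2 powr (- \<alpha> * real d) * (a + b * real d))"
proof -
  define y where "y = 2 powr (- \<alpha>)"
  have y: "norm y < 1" using assms by (simp add: y_def powr_less_one)
  have "summable (\<lambda>d. (a - b) * y ^ d + b * (of_nat (Suc d) * y ^ d))"
    using geometric_deriv_sums[OF y]
    by (intro summable_add summable_mult summable_geometric[OF y]) (auto simp: summable_def)
  moreover have "2 powr (- \<alpha> * real d) * (a + b * real d)
      = (a - b) * y ^ d + b * (of_nat (Suc d) * y ^ d)" for d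
    by (simp add: y_def powr_powr algebra_simps flip: powr_realpow)
  ultimately show ?thesis by simp
qed

lemma powr_inverse_le_self:
  fixes w p :: real
  assumes "1 \<le> w" "1 \<le> p" shows "w powr (1 / p) \<le> w"
proof -
  have "w powr (1 / p) \<le> w powr 1" using assms by (intro powr_mono) auto
  then show ?thesis using assms by simp
qed

context kernel_modulus begin

text \<open>Here \<open>2\<^sup>L\<close> is the budget and also the number of grid points at level \<open>L\<close>. A coarser level
  \<open>l\<close> has the price \<open>2\<^sup>-\<^sup>s\<^sup>(\<^sup>L\<^sup>-\<^sup>l\<^sup>)\<close>: its few counters cost at most \<open>1 + s(L - l)\<close> bits each, and the
  choice \<open>s = (\<alpha> + 1) p\<close> makes its tolerance smaller than that of level \<open>L\<close> by the factor
  \<open>2\<^sup>-\<^sup>(\<^sup>L\<^sup>-\<^sup>l\<^sup>)\<close>. A finer level has the price \<open>1 + 2(l - L)\<close>, which outweighs the growth of the number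
  of its points and worsens the tolerance only by a linear factor, against the geometric decay
  of the modulus.\<close>
lemma polynomial_modulus_dyadic:
  assumes \<alpha>: "0 < \<alpha>" and C: "0 < C" and \<Omega>: "\<And>a. \<Omega> a \<le> C * 2 powr (- \<alpha> * real a)"
  obtains C1 C2 where "1 \<le> C1" "0 < C2"
    "\<And>L n. 1 + C1 * 2 ^ L \<le> real n \<Longrightarrow>
      operator_entropy_number p K n \<le> C2 * 2 powr (- (\<alpha> + 1 / p) * real L)"
proof -
  define s where "s = (\<alpha> + 1) * p"
  have s: "0 < s" using \<alpha> p_pos by (simp add: s_def)
  define F1 where "F1 d = 2 powr (- 1 * real d) * (1 + s * real d)" for d :: nat
  define F2 where "F2 d = 2 powr (- 1 * real d) * (1 + 0 * real d)" for d :: nat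
  define G1 where "G1 d = 2 powr (- 1 * real d) * (1 + 0 * real d)" for d :: nat
  define G2 where "G2 d = 2 powr (- \<alpha> * real d) * (1 + 2 * real d)" for d :: nat
  have sm: "summable F1" "summable F2" "summable G1" "summable G2"
    unfolding F1_def[abs_def] F2_def[abs_def] G1_def[abs_def] G2_def[abs_def]
    by (intro summable_linear_geometric; use \<alpha> in simp)+
  have nn: "0 \<le> F1 d" "0 \<le> F2 d" "0 \<le> G1 d" "0 \<le> G2 d" for d
    using s by (auto simp: F1_def F2_def G1_def G2_def)
  define C1 where "C1 = 1 + 4 * (suminf F1 + suminf F2)"
  define C2 where "C2 = 6 * (C * 2 powr \<alpha> * (suminf G1 + suminf G2)) + 2 * C"
  have C1: "1 \<le> C1" using suminf_nonneg[OF sm(1) nn(1)] suminf_nonneg[OF sm(2) nn(2)] by (simp add: C1_def)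
  have "0 \<le> C * 2 powr \<alpha> * (suminf G1 + suminf G2)"
    using C suminf_nonneg[OF sm(3) nn(3)] suminf_nonneg[OF sm(4) nn(4)] by simp
  then have C2: "0 < C2" using C unfolding C2_def by linarith
  have main: "operator_entropy_number p K n \<le> C2 * 2 powr (- (\<alpha> + 1 / p) * real L)"
    if n: "1 + C1 * 2 ^ L \<le> real n" for L n
  proof -
    define w where "w l = (if l \<le> L then 2 powr (- s * real (L - l)) else 1 + 2 * real (l - L))" for l
    \<comment> \<open>The last level is chosen so that the modulus there is below the target accuracy.\<close>
    define m where "m = L + nat \<lceil>real L / (p * \<alpha>)\<rceil>"
    define x where "x = (2 :: real) ^ L"
    have w: "0 < w l" for l by (simp add: w_def)
    have x: "0 < x" by (simp add: x_def)
    have cost: "2 * (2 ^ l + 1) * bit_cost (w l) \<le> 4 * x * (if l \<le> L then F1 (L - l) else F2 (l - L))" for l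
    proof -
      have "2 * (2 ^ l + 1) * bit_cost (w l) \<le> 4 * 2 ^ l * bit_cost (w l)"
      proof (rule mult_right_mono)
        show "0 \<le> bit_cost (w l)" using w[of l] by (simp add: bit_cost_def powr_less_one)
      qed simp
      moreover have "2 ^ l * bit_cost (w l) \<le> x * (if l \<le> L then F1 (L - l) else F2 (l - L))"
      proof (cases "l \<le> L")
        case True
        have "2 powr (- s * real (L - l)) \<le> 2 powr 0" using s by (intro powr_mono) auto
        also have "2 powr 0 = (1 :: real)" by simp
        finally have "bit_cost (w l) \<le> 1 - log 2 (w l)"
          using True by (intro bit_cost_small w) (simp only: w_def if_True)
        also have "\<dots> = 1 + s * real (L - l)" using True by (simp add: w_def)
        finally have "2 ^ l * bit_cost (w l) \<le> 2 ^ l * (1 + s * real (L - l))" by simp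
        moreover have "(2 :: real) ^ l = x * 2 powr (- 1 * real (L - l))"
          using True by (simp add: x_def of_nat_diff flip: powr_realpow powr_add)
        then have "2 ^ l * (1 + s * real (L - l)) = x * F1 (L - l)" by (simp add: F1_def)
        ultimately show ?thesis unfolding if_P[OF True] by (rule ord_le_eq_trans)
      next
        case False
        have "bit_cost (w l) \<le> 2 * 2 powr (- w l)"
          using False by (intro bit_cost_large) (simp add: w_def)
        also have "\<dots> = 2 powr (1 - w l)" by (simp add: powr_diff powr_minus divide_inverse)
        finally have "2 ^ l * bit_cost (w l) \<le> 2 ^ l * 2 powr (1 - w l)" by simp
        also have "\<dots> = x * 2 powr (- 1 * real (l - L))"
          using False by (simp add: w_def x_def of_nat_diff flip: powr_realpow powr_add)
        finally show ?thesis using False by (simp add: F2_def)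
      qed
      then have "4 * 2 ^ l * bit_cost (w l) \<le> 4 * x * (if l \<le> L then F1 (L - l) else F2 (l - L))"
        unfolding mult.assoc by (intro mult_left_mono) auto
      ultimately show ?thesis by (rule order.trans)
    qed
    have "(\<Sum>l\<le>m. 2 * (2 ^ l + 1) * bit_cost (w l))
        \<le> (\<Sum>l\<le>m. 4 * x * (if l \<le> L then F1 (L - l) else F2 (l - L)))"
      by (intro sum_mono cost)
    also have "\<dots> = 4 * x * (\<Sum>l\<le>m. if l \<le> L then F1 (L - l) else F2 (l - L))"
      by (rule sum_distrib_left[symmetric])
    also have "\<dots> \<le> 4 * x * (suminf F1 + suminf F2)"
      using x by (intro mult_left_mono sum_two_sided_le sm nn) auto
    finally have budget: "x + (\<Sum>l\<le>m. 2 * (2 ^ l + 1) * bit_cost (w l)) \<le> real n - 1"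
      using n by (simp add: C1_def x_def algebra_simps)
    define A where "A = 2 powr (- (\<alpha> + 1 / p) * real L)"
    have eps: "\<Omega> (if l = 0 then 0 else l - 1) * (w l / x) powr (1 / p)
        \<le> C * 2 powr \<alpha> * A * (if l \<le> L then G1 (L - l) else G2 (l - L))" for l
    proof -
      have "\<Omega> (if l = 0 then 0 else l - 1) \<le> C * 2 powr (- \<alpha> * real (if l = 0 then 0 else l - 1))"
        by (rule \<Omega>)
      also have "\<dots> \<le> C * 2 powr (\<alpha> + - \<alpha> * real l)"
        using C \<alpha> by (intro mult_left_mono powr_mono) (auto simp: of_nat_diff algebra_simps)
      finally have 1: "\<Omega> (if l = 0 then 0 else l - 1) \<le> C * 2 powr \<alpha> * 2 powr (- \<alpha> * real l)"
        unfolding powr_add mult.assoc .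
      have 2: "(w l / x) powr (1 / p) = w l powr (1 / p) * 2 powr (- real L / p)"
      proof -
        have "x powr (1 / p) = 2 powr (real L / p)" by (simp add: x_def powr_powr flip: powr_realpow)
        then have "(w l / x) powr (1 / p) = w l powr (1 / p) / 2 powr (real L / p)"
          using w[of l] x by (simp add: powr_divide)
        also have "\<dots> = w l powr (1 / p) * 2 powr (- (real L / p))" by (simp add: powr_minus_divide)
        finally show ?thesis by simp
      qed
      have 3: "2 powr (- \<alpha> * real l) * (w l powr (1 / p) * 2 powr (- real L / p))
          \<le> A * (if l \<le> L then G1 (L - l) else G2 (l - L))"
      proof (cases "l \<le> L")
        case True
        have "w l powr (1 / p) = 2 powr (- (\<alpha> + 1) * real (L - l))"
        proof -
          have "s / p = \<alpha> + 1" using p_pos by (simp add: s_def)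
          moreover have "- s * real (L - l) * (1 / p) = - (s / p) * real (L - l)" by simp
          ultimately have "- s * real (L - l) * (1 / p) = - (\<alpha> + 1) * real (L - l)" by (simp only:)
          then show ?thesis unfolding w_def if_P[OF True] powr_powr by (rule arg_cong)
        qed
        then have "2 powr (- \<alpha> * real l) * (w l powr (1 / p) * 2 powr (- real L / p))
            = 2 powr (- \<alpha> * real l + (- (\<alpha> + 1) * real (L - l) + - real L / p))"
          by (simp only: powr_add)
        also have "- \<alpha> * real l + (- (\<alpha> + 1) * real (L - l) + - real L / p)
            = - (\<alpha> + 1 / p) * real L + - 1 * real (L - l)"
          using True by (simp add: of_nat_diff algebra_simps)
        finally show ?thesis using True by (simp add: A_def G1_def powr_add)
      next
        case False
        have "w l powr (1 / p) \<le> 1 + 2 * real (l - L)"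
          using False powr_inverse_le_self[of "w l" p] p_ge_2 by (simp add: w_def)
        then have "2 powr (- \<alpha> * real l) * (w l powr (1 / p) * 2 powr (- real L / p))
          \<le> 2 powr (- \<alpha> * real l) * ((1 + 2 * real (l - L)) * 2 powr (- real L / p))"
          by (intro mult_left_mono mult_right_mono) auto
        also have "\<dots> = 2 powr (- \<alpha> * real l + - real L / p) * (1 + 2 * real (l - L))"
          by (simp only: powr_add mult_ac)
        also have "- \<alpha> * real l + - real L / p = - (\<alpha> + 1 / p) * real L + - \<alpha> * real (l - L)"
          using False by (simp add: of_nat_diff algebra_simps)
        finally show ?thesis using False unfolding A_def G2_def powr_add by (simp add: mult.assoc)
      qed
      have "\<Omega> (if l = 0 then 0 else l - 1) * (w l / x) powr (1 / p)
          \<le> C * 2 powr \<alpha> * 2 powr (- \<alpha> * real l) * (w l / x) powr (1 / p)"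
        using 1 by (intro mult_right_mono) auto
      also have "\<dots> = C * 2 powr \<alpha> * (2 powr (- \<alpha> * real l) * (w l powr (1 / p) * 2 powr (- real L / p)))"
        by (simp add: 2)
      also have "\<dots> \<le> C * 2 powr \<alpha> * (A * (if l \<le> L then G1 (L - l) else G2 (l - L)))"
        using C by (intro mult_left_mono 3) auto
      finally show ?thesis by (simp add: mult.assoc)
    qed
    have "(\<Sum>l\<le>m. \<Omega> (if l = 0 then 0 else l - 1) * (w l / x) powr (1 / p))
        \<le> (\<Sum>l\<le>m. C * 2 powr \<alpha> * A * (if l \<le> L then G1 (L - l) else G2 (l - L)))"
      by (intro sum_mono eps)
    also have "\<dots> = C * 2 powr \<alpha> * A * (\<Sum>l\<le>m. if l \<le> L then G1 (L - l) else G2 (l - L))"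
      by (rule sum_distrib_left[symmetric])
    also have "\<dots> \<le> C * 2 powr \<alpha> * A * (suminf G1 + suminf G2)"
      using C by (intro mult_left_mono sum_two_sided_le sm nn) (auto simp: A_def)
    finally have sum_le: "(\<Sum>l\<le>m. \<Omega> (if l = 0 then 0 else l - 1) * (w l / x) powr (1 / p))
        \<le> C * 2 powr \<alpha> * A * (suminf G1 + suminf G2)" .
    have "real L / (p * \<alpha>) \<le> real (nat \<lceil>real L / (p * \<alpha>)\<rceil>)" by linarith
    then have "real L + real L / (p * \<alpha>) \<le> real m" by (simp add: m_def)
    then have "\<alpha> * (real L + real L / (p * \<alpha>)) \<le> \<alpha> * real m" using \<alpha> by (intro mult_left_mono) auto
    then have "- \<alpha> * real m \<le> - (\<alpha> + 1 / p) * real L" using \<alpha> by (simp add: algebra_simps)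
    then have "2 powr (- \<alpha> * real m) \<le> A" unfolding A_def by (intro powr_mono) auto
    then have "C * 2 powr (- \<alpha> * real m) \<le> C * A" using C by simp
    then have tail: "\<Omega> m \<le> C * A" using \<Omega>[of m] by linarith
    have "operator_entropy_number p K n
        \<le> 6 * (\<Sum>l\<le>m. \<Omega> (if l = 0 then 0 else l - 1) * (w l / x) powr (1 / p)) + 2 * \<Omega> m"
      using chaining[of "\<lambda>l. l" w x m n] w x budget by (simp add: mono_def)
    also have "\<dots> \<le> 6 * (C * 2 powr \<alpha> * A * (suminf G1 + suminf G2)) + 2 * (C * A)"
      using sum_le tail by (intro add_mono mult_left_mono) auto
    also have "\<dots> = C2 * A" by (simp add: C2_def algebra_simps)
    finally show ?thesis by (simp add: A_def)
  qed
  show ?thesis by (rule that[OF C1 C2 main])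
qed

lemma entropy_polynomial_modulus:
  assumes \<alpha>: "0 < \<alpha>" and C: "0 < C" and \<Omega>: "\<And>a. \<Omega> a \<le> C * 2 powr (- \<alpha> * real a)"
  shows "operator_entropy_number p K \<preceq> (\<lambda>n. real n powr (- (\<alpha> + 1 / p)))"
proof -
  obtain C1 C2 where C1: "1 \<le> C1" and C2: "0 < C2" and
    main: "\<And>L n. 1 + C1 * 2 ^ L \<le> real n \<Longrightarrow>
      operator_entropy_number p K n \<le> C2 * 2 powr (- (\<alpha> + 1 / p) * real L)"
    using polynomial_modulus_dyadic[OF assms] by metis
  define \<theta> where "\<theta> = \<alpha> + 1 / p"
  have \<theta>: "0 < \<theta>" using \<alpha> p_pos by (simp add: \<theta>_def add_pos_pos)
  show ?thesis
  proof (rule dominated_by_eventually[where N = "nat \<lceil>1 + C1\<rceil>" and c = "C2 * (4 * C1) powr \<theta>"])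
    fix n assume "nat \<lceil>1 + C1\<rceil> \<le> n"
    then have n: "1 + C1 \<le> real n" by linarith
    obtain L where L: "2 ^ L \<le> (real n - 1) / C1" "(real n - 1) / C1 < 2 ^ (L + 1)"
      using ex_power_between[of 2 "(real n - 1) / C1"] n C1 by auto
    have "real n \<le> 4 * C1 * 2 ^ L" using L(2) n C1 by (simp add: field_simps)
    then have "real n powr \<theta> \<le> (4 * C1 * 2 ^ L) powr \<theta>" using \<theta> by (intro powr_mono2) auto
    also have "\<dots> = (4 * C1) powr \<theta> * 2 powr (\<theta> * real L)"
      using C1 by (simp add: powr_mult powr_powr mult.commute flip: powr_realpow)
    finally have "2 powr (- \<theta> * real L) \<le> (4 * C1) powr \<theta> * real n powr (- \<theta>)"
      using n C1 by (simp add: powr_minus field_simps)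
    then have "C2 * 2 powr (- \<theta> * real L) \<le> C2 * ((4 * C1) powr \<theta> * real n powr (- \<theta>))"
      using C2 by simp
    moreover have "operator_entropy_number p K n \<le> C2 * 2 powr (- \<theta> * real L)"
      unfolding \<theta>_def using L(1) C1 by (intro main) (simp add: field_simps)
    ultimately show "operator_entropy_number p K n \<le> C2 * (4 * C1) powr \<theta> * real n powr (- (\<alpha> + 1 / p))"
      by (simp add: \<theta>_def mult.assoc)
  qed auto
qed

end

section \<open>Entropy numbers under a logarithmic modulus\<close>

lemma sum_half_powers_le: "(\<Sum>l\<le>m. (1 / 2 :: real) ^ l) \<le> 2"
proof -
  have "(\<Sum>l\<le>m. (1 / 2 :: real) ^ l) \<le> (\<Sum>l. (1 / 2) ^ l)"
    by (intro sum_le_suminf summable_geometric) auto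
  then show ?thesis by (simp add: suminf_geometric)
qed

lemma inverse_power_antimono_real: "a \<le> b \<Longrightarrow> 1 / (2 :: real) ^ b \<le> 1 / 2 ^ a"
  by (simp add: frac_le)

text \<open>Passage from bounds at the dyadic budgets \<open>4\<^sup>L\<close> to a bound for every \<open>n\<close>: choose the largest
  \<open>L\<close> that \<open>n\<close> can pay for.\<close>
lemma dyadic_to_sequence:
  fixes u :: "nat \<Rightarrow> real" and y :: "nat \<Rightarrow> real"
  assumes C1: "1 \<le> C1" and y: "\<And>n. 1 \<le> n \<Longrightarrow> 0 < y n"
    and bound: "\<And>L n. 1 \<le> L \<Longrightarrow> 1 + C1 * 4 ^ L \<le> real n \<Longrightarrow> u n \<le> C2 * v L"
    and C2: "0 \<le> C2"
    and compare: "\<And>L n. 1 \<le> L \<Longrightarrow> 4 ^ L \<le> real n \<Longrightarrow> real n \<le> 8 * C1 * 4 ^ L \<Longrightarrow> v L \<le> c * y n"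
  shows "u \<preceq> y"
proof (rule dominated_by_eventually[where N = "nat \<lceil>1 + 4 * C1\<rceil>" and c = "C2 * c", OF y])
  fix n assume "nat \<lceil>1 + 4 * C1\<rceil> \<le> n"
  then have n: "1 + 4 * C1 \<le> real n" by linarith
  have y4: "4 \<le> (real n - 1) / C1" using n C1 by (simp add: field_simps)
  then obtain L where L: "4 ^ L \<le> (real n - 1) / C1" "(real n - 1) / C1 < 4 ^ (L + 1)"
    using ex_power_between[of 4 "(real n - 1) / C1"] by auto
  have L1: "1 \<le> L"
  proof (rule ccontr)
    assume "\<not> 1 \<le> L"
    then show False using L(2) y4 by (simp add: not_le)
  qed
  have 1: "1 + C1 * 4 ^ L \<le> real n" using L(1) C1 by (simp add: field_simps)
  have "1 * 4 ^ L \<le> C1 * 4 ^ L" using C1 by (intro mult_right_mono) auto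
  then have 2: "4 ^ L \<le> real n" using 1 by linarith
  have 3: "real n \<le> 8 * C1 * 4 ^ L" using L(2) n C1 by (simp add: field_simps)
  have "u n \<le> C2 * v L" by (rule bound[OF L1 1])
  also have "\<dots> \<le> C2 * (c * y n)" using C2 by (intro mult_left_mono compare L1 2 3)
  finally show "u n \<le> C2 * c * y n" by (simp add: mult.assoc)
qed

lemma powr_le_of_dyadic:
  fixes n :: nat
  assumes "0 < B" "1 \<le> real n" "real n \<le> B * 4 ^ L" "0 < \<theta>"
  shows "4 powr (- real L * \<theta>) \<le> B powr \<theta> * real n powr (- \<theta>)"
proof -
  have "real n powr \<theta> \<le> (B * 4 ^ L) powr \<theta>" using assms by (intro powr_mono2) auto
  also have "\<dots> = B powr \<theta> * 4 powr (real L * \<theta>)"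
    using assms by (simp add: powr_mult powr_powr flip: powr_realpow)
  finally show ?thesis using assms by (simp add: powr_minus field_simps)
qed

context kernel_modulus begin

text \<open>The levels \<open>2\<^sup>l L\<close> double, because only doubling a level changes a logarithmic
  modulus by a factor. A point of level \<open>a = 2\<^sup>l L\<close> has the price \<open>2a\<close>, so that all levels
  with \<open>l \<ge> 1\<close> together add a bounded number of bits, and the tolerance is of the order of
  \<open>a\<^sup>-\<^sup>\<gamma> (a/x)\<^sup>1\<^sup>/\<^sup>p\<close> with the budget \<open>x = 4\<^sup>L\<close>. The base grid has only \<open>2\<^sup>L\<close> points, the square root of the
  budget; it can afford an exponentially small price, so no coarser grids are required.\<close>
lemma logarithmic_modulus_dyadic:
  assumes \<gamma>: "0 < \<gamma>" and C: "0 < C" and \<Omega>: "\<And>a. \<Omega> a \<le> C * (1 + real a) powr (- \<gamma>)"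
  defines "e \<equiv> 1 / p - \<gamma>"
  obtains C1 C2 where "1 \<le> C1" "0 < C2"
    "\<And>L m n. 1 \<le> L \<Longrightarrow> 1 + C1 * 4 ^ L \<le> real n \<Longrightarrow> operator_entropy_number p K n
      \<le> C2 * (4 powr (- real L / p) * real L powr e * (\<Sum>l\<le>m. (2 powr e) ^ l)
               + (2 ^ m * real L) powr (- \<gamma>))"
proof -
  define s where "s = p * \<gamma>"
  have s: "0 < s" using \<gamma> p_pos by (simp add: s_def)
  define C1 where "C1 = 1 + 16 * (1 + s)"
  define C3 where "C3 = C * 2 powr (\<gamma> + 1)"
  define C2 where "C2 = 6 * C3 + 2 * C"
  have C1: "1 \<le> C1" using s by (simp add: C1_def)
  have C3: "0 < C3" "C \<le> C3"
  proof -
    have "2 powr 0 \<le> 2 powr (\<gamma> + 1)" using \<gamma> by (intro powr_mono) auto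
    then have "1 \<le> 2 powr (\<gamma> + 1)" by simp
    then have "C * 1 \<le> C * 2 powr (\<gamma> + 1)" using C by (intro mult_left_mono) auto
    then show "C \<le> C3" by (simp add: C3_def)
    then show "0 < C3" using C by linarith
  qed
  have C2: "0 < C2" using C C3 by (simp add: C2_def)
  have main: "operator_entropy_number p K n
      \<le> C2 * (4 powr (- real L / p) * real L powr e * (\<Sum>l\<le>m. (2 powr e) ^ l)
               + (2 ^ m * real L) powr (- \<gamma>))"
    if L: "1 \<le> L" and n: "1 + C1 * 4 ^ L \<le> real n" for L m n
  proof -
    define level where "level l = 2 ^ l * L" for l :: nat
    define w where "w l = (if l = 0 then 2 powr (- s * real L) else 2 * real (level l))" for l
    define x where "x = (4 :: real) ^ L"
    have level_ge: "2 ^ l \<le> level l" for l using L by (simp add: level_def)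
    have level_gt: "l + 1 \<le> level l" for l
      using level_ge[of l] less_exp[of l] by linarith
    have w: "0 < w l" for l using level_gt[of l] by (simp add: w_def)
    have x: "0 < x" by (simp add: x_def)
    have x4: "x = 2 ^ L * 2 ^ L" by (simp add: x_def flip: power_mult_distrib)
    have Lx: "real L \<le> 2 ^ L" by (simp add: less_imp_le of_nat_less_two_power)
    have cost: "2 * (2 ^ level l + 1) * bit_cost (w l) \<le> 8 * (1 + s) * x * (1 / 2) ^ l" for l
    proof -
      have b0: "0 \<le> bit_cost (w l)" using w[of l] by (simp add: bit_cost_def powr_less_one)
      have "(2 :: real) * (2 ^ level l + 1) \<le> 4 * 2 ^ level l" by simp
      then have 1: "2 * (2 ^ level l + 1) * bit_cost (w l) \<le> 4 * 2 ^ level l * bit_cost (w l)"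
        using b0 by (rule mult_right_mono)
      show ?thesis
      proof (cases "l = 0")
        case True
        have w0: "w l = 2 powr (- s * real L)" using True by (simp add: w_def)
        have "2 powr (- s * real L) \<le> 2 powr 0" using s by (intro powr_mono) auto
        then have "bit_cost (w l) \<le> 1 - log 2 (w l)" unfolding w0 by (intro bit_cost_small) auto
        also have "\<dots> = 1 + s * real L" by (simp add: w0)
        also have "\<dots> \<le> 2 ^ L + s * 2 ^ L" using Lx s by (intro add_mono mult_left_mono) auto
        also have "\<dots> = (1 + s) * 2 ^ L" by (simp add: algebra_simps)
        finally have "4 * 2 ^ L * bit_cost (w l) \<le> 4 * 2 ^ L * ((1 + s) * 2 ^ L)"
          by (intro mult_left_mono) auto
        also have "\<dots> = 4 * ((1 + s) * x)" by (simp add: x4)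
        also have "\<dots> \<le> 8 * (1 + s) * x" using s x by simp
        finally show ?thesis using 1 True by (simp add: level_def)
      next
        case False
        have wl: "w l = real (2 * level l)" using False by (simp add: w_def)
        have "bit_cost (w l) \<le> 2 * 2 powr (- w l)"
          using level_gt[of l] by (intro bit_cost_large) (simp add: wl)
        also have "2 powr (- w l) = 1 / (2 ^ level l * 2 ^ level l)"
          unfolding wl powr_minus_divide powr_realpow[OF zero_less_numeral] mult_2 power_add ..
        finally have "4 * 2 ^ level l * bit_cost (w l) \<le> 4 * 2 ^ level l * (2 * (1 / (2 ^ level l * 2 ^ level l)))"
          by (intro mult_left_mono) auto
        also have "\<dots> = 8 * (1 / 2 ^ level l)" by simp
        also have "\<dots> \<le> 8 * (1 / 2 ^ l)"
          using level_gt[of l] by (intro mult_left_mono inverse_power_antimono_real) auto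
        also have "\<dots> \<le> 8 * ((1 + s) * x) * (1 / 2 ^ l)"
        proof -
          have "1 * 1 \<le> (1 + s) * x" using s by (intro mult_mono) (auto simp: x_def)
          then show ?thesis by (intro mult_right_mono) auto
        qed
        finally have "4 * 2 ^ level l * bit_cost (w l) \<le> 8 * (1 + s) * x * (1 / 2) ^ l"
          by (simp only: power_one_over mult.assoc)
        with 1 show ?thesis by (rule order.trans)
      qed
    qed
    have "(\<Sum>l\<le>m. 2 * (2 ^ level l + 1) * bit_cost (w l)) \<le> (\<Sum>l\<le>m. 8 * (1 + s) * x * (1 / 2) ^ l)"
      by (intro sum_mono cost)
    also have "\<dots> = 8 * (1 + s) * x * (\<Sum>l\<le>m. (1 / 2) ^ l)" by (rule sum_distrib_left[symmetric])
    also have "\<dots> \<le> 8 * (1 + s) * x * 2"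
      using s x by (intro mult_left_mono sum_half_powers_le) auto
    finally have budget: "x + (\<Sum>l\<le>m. 2 * (2 ^ level l + 1) * bit_cost (w l)) \<le> real n - 1"
      using n by (simp add: C1_def x_def algebra_simps)
    define A where "A = 4 powr (- real L / p) * real L powr e"
    have A: "0 \<le> A" by (simp add: A_def)
    have x_powr: "(v / x) powr (1 / p) = v powr (1 / p) * 4 powr (- real L / p)" if "0 < v" for v
    proof -
      have "x powr (1 / p) = 4 powr (real L / p)" by (simp add: x_def powr_powr flip: powr_realpow)
      then have "(v / x) powr (1 / p) = v powr (1 / p) / 4 powr (real L / p)"
        using that x by (simp add: powr_divide)
      also have "\<dots> = v powr (1 / p) * 4 powr (- (real L / p))" by (simp add: powr_minus_divide)
      finally show ?thesis by simp
    qed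
    have eps: "\<Omega> (if l = 0 then 0 else level (l - 1)) * (w l / x) powr (1 / p) \<le> C3 * A * (2 powr e) ^ l" for l
    proof (cases "l = 0")
      case True
      have "\<Omega> 0 \<le> C3" using \<Omega>[of 0] C3(2) by simp
      moreover have "w l powr (1 / p) = 2 powr (- (\<gamma> * real L))"
        using True p_pos by (simp add: w_def s_def powr_powr)
      moreover have "2 powr (- (\<gamma> * real L)) \<le> real L powr e"
      proof -
        have "real L powr \<gamma> \<le> (2 ^ L) powr \<gamma>" using Lx \<gamma> by (intro powr_mono2) auto
        also have "\<dots> = 2 powr (\<gamma> * real L)" by (simp add: powr_powr mult.commute flip: powr_realpow)
        finally have "2 powr (- (\<gamma> * real L)) \<le> real L powr (- \<gamma>)"
          using L by (simp add: powr_minus le_imp_inverse_le)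
        also have "\<dots> \<le> real L powr e" using L p_pos by (intro powr_mono) (auto simp: e_def)
        finally show ?thesis .
      qed
      ultimately have "\<Omega> 0 * (w l powr (1 / p) * 4 powr (- real L / p))
          \<le> C3 * (real L powr e * 4 powr (- real L / p))"
        using C3 by (intro mult_mono mult_right_mono) auto
      then show ?thesis using True unfolding x_powr[OF w] by (simp add: A_def mult_ac)
    next
      case False
      define b where "b = real (level l)"
      have b: "0 < b" using level_gt[of l] by (simp add: b_def)
      have b_eq: "b = 2 ^ l * real L" by (simp add: b_def level_def)
      have half: "real (level (l - 1)) = b / 2"
        using False by (cases l) (simp_all add: b_def level_def)
      have "\<Omega> (level (l - 1)) \<le> C * (1 + b / 2) powr (- \<gamma>)" using \<Omega>[of "level (l - 1)"] unfolding half .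
      also have "\<dots> \<le> C * (b / 2) powr (- \<gamma>)"
        using b \<gamma> C by (intro mult_left_mono powr_mono2') auto
      also have "(b / 2) powr (- \<gamma>) = 2 powr \<gamma> * b powr (- \<gamma>)"
        using b by (simp add: powr_divide powr_minus field_simps)
      finally have 1: "\<Omega> (level (l - 1)) \<le> C * (2 powr \<gamma> * b powr (- \<gamma>))" .
      have wl: "w l = 2 * b" using False by (simp add: w_def b_def)
      have "w l powr (1 / p) = 2 powr (1 / p) * b powr (1 / p)" using b by (simp add: wl powr_mult)
      also have "\<dots> \<le> 2 * b powr (1 / p)"
        using powr_inverse_le_self[of 2 p] p_ge_2 by (intro mult_right_mono) auto
      finally have 2: "w l powr (1 / p) \<le> 2 * b powr (1 / p)" .
      have "\<Omega> (level (l - 1)) * (w l / x) powr (1 / p)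
          = \<Omega> (level (l - 1)) * (w l powr (1 / p) * 4 powr (- real L / p))"
        by (simp only: x_powr[OF w])
      also have "\<dots> \<le> C * (2 powr \<gamma> * b powr (- \<gamma>)) * (2 * b powr (1 / p) * 4 powr (- real L / p))"
        using C by (intro mult_mono 1 mult_right_mono 2) auto
      also have "\<dots> = C * (2 powr \<gamma> * 2) * (b powr (- \<gamma>) * b powr (1 / p)) * 4 powr (- real L / p)"
        by (simp only: mult_ac)
      also have "2 powr \<gamma> * 2 = 2 powr (\<gamma> + 1)" by (simp add: powr_add)
      also have "b powr (- \<gamma>) * b powr (1 / p) = b powr e" by (simp add: e_def flip: powr_add)
      also have "b powr e = (2 powr e) ^ l * real L powr e"
        by (simp add: b_eq powr_mult powr_powr mult.commute flip: powr_realpow)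
      finally show ?thesis using False by (simp add: A_def C3_def mult_ac)
    qed
    have "(\<Sum>l\<le>m. \<Omega> (if l = 0 then 0 else level (l - 1)) * (w l / x) powr (1 / p))
        \<le> (\<Sum>l\<le>m. C3 * A * (2 powr e) ^ l)"
      by (intro sum_mono eps)
    also have "\<dots> = C3 * A * (\<Sum>l\<le>m. (2 powr e) ^ l)" by (rule sum_distrib_left[symmetric])
    finally have sum_le: "(\<Sum>l\<le>m. \<Omega> (if l = 0 then 0 else level (l - 1)) * (w l / x) powr (1 / p))
        \<le> C3 * A * (\<Sum>l\<le>m. (2 powr e) ^ l)" .
    have lm: "real (level m) = 2 ^ m * real L" by (simp add: level_def)
    have "\<Omega> (level m) \<le> C * (1 + real (level m)) powr (- \<gamma>)" by (rule \<Omega>)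
    also have "\<dots> \<le> C * real (level m) powr (- \<gamma>)"
      using level_gt[of m] \<gamma> C by (intro mult_left_mono powr_mono2') auto
    finally have tail: "\<Omega> (level m) \<le> C * (2 ^ m * real L) powr (- \<gamma>)" unfolding lm .
    have mono: "mono level" by (rule monoI) (simp add: level_def)
    define S where "S = A * (\<Sum>l\<le>m. (2 powr e) ^ l)"
    define R where "R = (2 ^ m * real L) powr (- \<gamma>)"
    have S: "0 \<le> S" using A by (auto simp: S_def intro!: mult_nonneg_nonneg sum_nonneg)
    have R: "0 \<le> R" by (simp add: R_def)
    have "operator_entropy_number p K n
        \<le> 6 * (\<Sum>l\<le>m. \<Omega> (if l = 0 then 0 else level (l - 1)) * (w l / x) powr (1 / p)) + 2 * \<Omega> (level m)"
      by (rule chaining[OF mono w x budget])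
    also have "\<dots> \<le> 6 * (C3 * S) + 2 * (C * R)"
      using sum_le tail by (intro add_mono mult_left_mono) (auto simp: S_def R_def mult.assoc)
    also have "\<dots> \<le> C2 * S + C2 * R"
    proof (rule add_mono)
      have "6 * C3 * S \<le> C2 * S" using C S unfolding C2_def by (intro mult_right_mono) auto
      then show "6 * (C3 * S) \<le> C2 * S" by (simp add: mult.assoc)
      have "2 * C * R \<le> C2 * R" using C3 R unfolding C2_def by (intro mult_right_mono) auto
      then show "2 * (C * R) \<le> C2 * R" by (simp add: mult.assoc)
    qed
    finally show ?thesis by (simp only: S_def R_def A_def distrib_left)
  qed
  show ?thesis by (rule that[OF C1 C2 main])
qed

text \<open>It remains to choose the number of levels. For \<open>\<gamma> < 1/p\<close> the tolerances grow with the level, and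
  the last level has to be close to the budget \<open>4\<^sup>L\<close>; otherwise a number of levels
  proportional to \<open>L\<close> suffices.\<close>
lemma entropy_logarithmic_modulus:
  assumes \<gamma>: "0 < \<gamma>" and C: "0 < C" and \<Omega>: "\<And>a. \<Omega> a \<le> C * (1 + real a) powr (- \<gamma>)"
  shows "\<gamma> < 1 / p \<Longrightarrow> operator_entropy_number p K \<preceq> (\<lambda>n. real n powr (- \<gamma>))"
    and "\<gamma> = 1 / p \<Longrightarrow> operator_entropy_number p K \<preceq> (\<lambda>n. real n powr (- 1 / p) * log 2 (real n + 1))"
    and "1 / p < \<gamma> \<Longrightarrow>
      operator_entropy_number p K \<preceq> (\<lambda>n. real n powr (- 1 / p) * log 2 (real n + 1) powr (1 / p - \<gamma>))"
proof -
  define e where "e = 1 / p - \<gamma>"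
  obtain C1 C2 where C1: "1 \<le> C1" and C2: "0 < C2" and
    main: "\<And>L m n. 1 \<le> L \<Longrightarrow> 1 + C1 * 4 ^ L \<le> real n \<Longrightarrow> operator_entropy_number p K n
      \<le> C2 * (4 powr (- real L / p) * real L powr e * (\<Sum>l\<le>m. (2 powr e) ^ l)
               + (2 ^ m * real L) powr (- \<gamma>))"
    using logarithmic_modulus_dyadic[OF assms] unfolding e_def by metis
  have ip: "0 < 1 / p" using p_pos by simp
  have n1: "1 \<le> real n" if "4 ^ L \<le> real n" for L n
    using that one_le_power[of "4 :: real" L] by linarith
  have n_p: "4 powr (- real L / p) \<le> (8 * C1) powr (1 / p) * real n powr (- 1 / p)"
    if "4 ^ L \<le> real n" "real n \<le> 8 * C1 * 4 ^ L" for L n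
    using powr_le_of_dyadic[OF _ n1[OF that(1)] that(2) ip] C1 by simp
  have log_ge: "real L \<le> log 2 (real n + 1)" if "4 ^ L \<le> real n" for L n
  proof -
    have "2 powr real L \<le> 4 powr real L" by (intro powr_mono2) auto
    also have "\<dots> = 4 ^ L" by (simp add: powr_realpow)
    also have "\<dots> \<le> real n + 1" using that by linarith
    finally show ?thesis by (simp add: le_log_iff)
  qed
  \<comment> \<open>With this many levels the truncation error falls below the size of the first level.\<close>
  define m where "m L = nat \<lceil>2 * real L / (p * \<gamma>)\<rceil>" for L :: nat
  have tail: "(2 ^ m L * real L) powr (- \<gamma>) \<le> 4 powr (- real L / p) * real L powr (- \<gamma>)" if L: "1 \<le> L" for L
  proof -
    have "2 * real L / (p * \<gamma>) \<le> real (m L)" unfolding m_def by linarith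
    then have "2 * real L / p \<le> real (m L) * \<gamma>" using \<gamma> p_pos by (simp add: field_simps)
    then have "2 powr (- (real (m L) * \<gamma>)) \<le> 2 powr (- (2 * real L / p))" by (intro powr_mono) auto
    also have "\<dots> = (2 powr 2) powr (- (real L / p))" unfolding powr_powr by simp
    also have "\<dots> = 4 powr (- real L / p)" by simp
    finally have "2 powr (- (real (m L) * \<gamma>)) * real L powr (- \<gamma>) \<le> 4 powr (- real L / p) * real L powr (- \<gamma>)"
      by (rule mult_right_mono) simp
    then show ?thesis by (simp add: powr_mult powr_powr flip: powr_realpow)
  qed
  show "operator_entropy_number p K \<preceq> (\<lambda>n. real n powr (- \<gamma>))" if "\<gamma> < 1 / p"
  proof -
    have e: "0 < e" using that by (simp add: e_def)
    define y where "y = 2 powr e"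
    have y: "1 < y" using e by (simp add: y_def)
    define C4 where "C4 = y / (y - 1) + 2 powr \<gamma>"
    show ?thesis
    proof (rule dyadic_to_sequence[where v = "\<lambda>L. C4 * 4 powr (- real L * \<gamma>)" and c = "C4 * (8 * C1) powr \<gamma>", OF C1])
      fix L n :: nat assume L: "1 \<le> L" and n: "1 + C1 * 4 ^ L \<le> real n"
      have "real L \<le> 4 ^ L" using of_nat_less_two_power[of L, where ?'a = real] power_mono[of "2 :: real" 4 L] by linarith
      then obtain k where k: "2 ^ k \<le> 4 ^ L / real L" "4 ^ L / real L < 2 ^ (k + 1)"
        using ex_power_between[of 2 "4 ^ L / real L"] L by auto
      have lo: "2 ^ k * real L \<le> 4 ^ L" and hi: "4 ^ L / 2 \<le> 2 ^ k * real L"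
        using k L by (auto simp: field_simps)
      have "(\<Sum>l\<le>k. y ^ l) = (y ^ Suc k - 1) / (y - 1)"
        using y geometric_sum[of y "Suc k"] by (simp add: lessThan_Suc_atMost)
      also have "\<dots> \<le> y ^ Suc k / (y - 1)" using y by (intro divide_right_mono) auto
      finally have sum: "(\<Sum>l\<le>k. y ^ l) \<le> y / (y - 1) * y ^ k" by simp
      have "real L powr e * (\<Sum>l\<le>k. y ^ l) \<le> real L powr e * (y / (y - 1) * y ^ k)"
        using sum by (rule mult_left_mono) simp
      also have "\<dots> = y / (y - 1) * (2 ^ k * real L) powr e"
        by (simp add: y_def powr_mult powr_powr mult_ac flip: powr_realpow)
      also have "\<dots> \<le> y / (y - 1) * (4 ^ L) powr e"
        using lo e y by (intro mult_left_mono powr_mono2) auto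
      also have "(4 ^ L) powr e = 4 powr (real L * e)" by (simp add: powr_powr flip: powr_realpow)
      finally have "4 powr (- real L / p) * (real L powr e * (\<Sum>l\<le>k. y ^ l))
          \<le> 4 powr (- real L / p) * (y / (y - 1) * 4 powr (real L * e))"
        by (rule mult_left_mono) simp
      also have "\<dots> = y / (y - 1) * 4 powr (- real L / p + real L * e)"
        by (simp only: powr_add mult_ac)
      also have "- real L / p + real L * e = - real L * \<gamma>" by (simp add: e_def algebra_simps)
      finally have 1: "4 powr (- real L / p) * (real L powr e * (\<Sum>l\<le>k. y ^ l))
          \<le> y / (y - 1) * 4 powr (- real L * \<gamma>)" .
      have "(2 ^ k * real L) powr (- \<gamma>) \<le> (4 ^ L / 2) powr (- \<gamma>)"
        using hi \<gamma> by (intro powr_mono2') auto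
      also have "\<dots> = (4 ^ L) powr (- \<gamma>) * 2 powr \<gamma>" by (simp add: powr_divide powr_minus field_simps)
      also have "(4 ^ L) powr (- \<gamma>) = 4 powr (- real L * \<gamma>)" by (simp add: powr_powr flip: powr_realpow)
      finally have 2: "(2 ^ k * real L) powr (- \<gamma>) \<le> 4 powr (- real L * \<gamma>) * 2 powr \<gamma>" .
      have "operator_entropy_number p K n \<le> C2 * (4 powr (- real L / p) * (real L powr e * (\<Sum>l\<le>k. y ^ l))
          + (2 ^ k * real L) powr (- \<gamma>))"
        using main[OF L n, of k] by (simp add: y_def mult.assoc)
      also have "\<dots> \<le> C2 * (y / (y - 1) * 4 powr (- real L * \<gamma>) + 4 powr (- real L * \<gamma>) * 2 powr \<gamma>)"
        using C2 by (intro mult_left_mono add_mono 1 2) auto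
      also have "\<dots> = C2 * (C4 * 4 powr (- real L * \<gamma>))" by (simp add: C4_def distrib_right)
      finally show "operator_entropy_number p K n \<le> C2 * (C4 * 4 powr (- real L * \<gamma>))" .
    next
      fix L n :: nat assume "4 ^ L \<le> real n" "real n \<le> 8 * C1 * 4 ^ L"
      then have "4 powr (- real L * \<gamma>) \<le> (8 * C1) powr \<gamma> * real n powr (- \<gamma>)"
        using C1 \<gamma> n1 by (intro powr_le_of_dyadic) auto
      moreover have "0 \<le> C4" using y by (simp add: C4_def)
      ultimately show "C4 * 4 powr (- real L * \<gamma>) \<le> C4 * (8 * C1) powr \<gamma> * real n powr (- \<gamma>)"
        unfolding mult.assoc by (rule mult_left_mono)
    qed (use C2 in auto)
  qed
  show "operator_entropy_number p K \<preceq> (\<lambda>n. real n powr (- 1 / p) * log 2 (real n + 1))" if "\<gamma> = 1 / p"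
  proof -
    have e: "e = 0" using that by (simp add: e_def)
    define C4 where "C4 = 3 + 2 / (p * \<gamma>)"
    have C4: "0 \<le> C4" using \<gamma> p_pos by (simp add: C4_def)
    show ?thesis
    proof (rule dyadic_to_sequence[where v = "\<lambda>L. C4 * (4 powr (- real L / p) * real L)" and c = "C4 * (8 * C1) powr (1 / p)", OF C1])
      fix L n :: nat assume L: "1 \<le> L" and n: "1 + C1 * 4 ^ L \<le> real n"
      have L0: "real L powr 0 = 1" using L by simp
      have "real (m L) \<le> 2 * real L / (p * \<gamma>) + 1" 
      proof -
        have "0 \<le> 2 * real L / (p * \<gamma>)" using \<gamma> p_pos by simp
        then show ?thesis unfolding m_def by linarith
      qed
      then have "real (m L) + 2 \<le> C4 * real L" using L by (simp add: C4_def algebra_simps)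
      then have 1: "4 powr (- real L / p) * (real (m L) + 2) \<le> 4 powr (- real L / p) * (C4 * real L)"
        by (rule mult_left_mono) simp
      have "real L powr (- \<gamma>) \<le> 1 powr (- \<gamma>)" using L \<gamma> by (intro powr_mono2') auto
      then have "4 powr (- real L / p) * real L powr (- \<gamma>) \<le> 4 powr (- real L / p) * 1"
        by (intro mult_left_mono) auto
      then have 2: "(2 ^ m L * real L) powr (- \<gamma>) \<le> 4 powr (- real L / p)" using tail[OF L] by linarith
      have "operator_entropy_number p K n \<le> C2 * (4 powr (- real L / p) * (real (m L) + 1)
          + (2 ^ m L * real L) powr (- \<gamma>))"
        using main[OF L n, of "m L"] L by (simp add: e add.commute)
      also have "\<dots> \<le> C2 * (4 powr (- real L / p) * (real (m L) + 1) + 4 powr (- real L / p))"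
        using C2 2 by simp
      also have "\<dots> = C2 * (4 powr (- real L / p) * (real (m L) + 2))" by (simp add: algebra_simps)
      also have "\<dots> \<le> C2 * (4 powr (- real L / p) * (C4 * real L))"
        using C2 1 by (intro mult_left_mono) auto
      finally show "operator_entropy_number p K n \<le> C2 * (C4 * (4 powr (- real L / p) * real L))"
        by (simp only: mult_ac)
    next
      fix L n :: nat assume n: "4 ^ L \<le> real n" "real n \<le> 8 * C1 * 4 ^ L"
      have "4 powr (- real L / p) * real L \<le> ((8 * C1) powr (1 / p) * real n powr (- 1 / p)) * log 2 (real n + 1)"
        by (intro mult_mono n_p n log_ge) auto
      then have "C4 * (4 powr (- real L / p) * real L)
          \<le> C4 * (((8 * C1) powr (1 / p) * real n powr (- 1 / p)) * log 2 (real n + 1))"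
        using C4 by (rule mult_left_mono)
      then show "C4 * (4 powr (- real L / p) * real L)
          \<le> C4 * (8 * C1) powr (1 / p) * (real n powr (- 1 / p) * log 2 (real n + 1))"
        by (simp only: mult.assoc)
    qed (use C2 in auto)
  qed
  show "operator_entropy_number p K \<preceq> (\<lambda>n. real n powr (- 1 / p) * log 2 (real n + 1) powr (1 / p - \<gamma>))"
    if "1 / p < \<gamma>"
  proof -
    have e: "e < 0" using that by (simp add: e_def)
    define y where "y = 2 powr e"
    have y: "0 < y" "y < 1" using e by (auto simp: y_def powr_less_one)
    define C4 where "C4 = 1 / (1 - y) + 1"
    have C4: "0 \<le> C4" using y by (simp add: C4_def)
    define B where "B = log 2 (8 * C1 + 1) + 2"
    have B: "0 < B" using C1 by (simp add: B_def add_pos_pos)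
    show ?thesis unfolding e_def[symmetric]
    proof (rule dyadic_to_sequence[where v = "\<lambda>L. C4 * (4 powr (- real L / p) * real L powr e)"
          and c = "C4 * (8 * C1) powr (1 / p) * B powr (- e)", OF C1])
      fix L n :: nat assume L: "1 \<le> L" and n: "1 + C1 * 4 ^ L \<le> real n"
      define D where "D = 4 powr (- real L / p) * real L powr e"
      have "(\<Sum>l\<le>m L. y ^ l) \<le> (\<Sum>l. y ^ l)"
        using y by (intro sum_le_suminf summable_geometric) auto
      also have "\<dots> = 1 / (1 - y)" using y by (intro suminf_geometric) auto
      finally have 1: "D * (\<Sum>l\<le>m L. y ^ l) \<le> D * (1 / (1 - y))"
        by (rule mult_left_mono) (simp add: D_def)
      have "real L powr (- \<gamma>) \<le> real L powr e" using L p_pos by (intro powr_mono) (auto simp: e_def)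
      then have "4 powr (- real L / p) * real L powr (- \<gamma>) \<le> D"
        unfolding D_def by (rule mult_left_mono) simp
      then have 2: "(2 ^ m L * real L) powr (- \<gamma>) \<le> D" using tail[OF L] by linarith
      have "operator_entropy_number p K n \<le> C2 * (D * (\<Sum>l\<le>m L. y ^ l) + (2 ^ m L * real L) powr (- \<gamma>))"
        unfolding D_def y_def by (rule main[OF L n])
      also have "\<dots> \<le> C2 * (D * (1 / (1 - y)) + D)"
        using C2 by (intro mult_left_mono add_mono 1 2) auto
      also have "\<dots> = C2 * (C4 * D)" by (simp add: C4_def algebra_simps)
      finally show "operator_entropy_number p K n \<le> C2 * (C4 * (4 powr (- real L / p) * real L powr e))"
        by (simp only: D_def)
    next
      fix L n :: nat assume L: "1 \<le> L" and n: "4 ^ L \<le> real n" "real n \<le> 8 * C1 * 4 ^ L"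
      have "real n + 1 \<le> 8 * C1 * 4 ^ L + 4 ^ L" using n(2) one_le_power[of "4 :: real" L] by linarith
      also have "\<dots> = (8 * C1 + 1) * 4 ^ L" by (simp add: algebra_simps)
      finally have "log 2 (real n + 1) \<le> log 2 ((8 * C1 + 1) * 4 ^ L)" by (intro log_mono) auto
      also have "\<dots> = log 2 (8 * C1 + 1) + real L * log 2 4" using C1 by (simp add: log_mult log_nat_power)
      also have "log 2 4 = (2 :: real)" using log_pow_cancel[of "2 :: real" 2] by simp
      also have "log 2 (8 * C1 + 1) + real L * 2 \<le> B * real L"
      proof -
        have "log 2 (8 * C1 + 1) * 1 \<le> log 2 (8 * C1 + 1) * real L"
          using L C1 by (intro mult_left_mono) auto
        then show ?thesis by (simp add: B_def algebra_simps)
      qed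
      finally have le: "log 2 (real n + 1) \<le> B * real L" .
      have pos: "0 < log 2 (real n + 1)" using n1[OF n(1)] by simp
      have "(B * real L) powr e \<le> log 2 (real n + 1) powr e" using pos le e by (intro powr_mono2') auto
      then have "B powr (- e) * (B * real L) powr e \<le> B powr (- e) * log 2 (real n + 1) powr e"
        by (rule mult_left_mono) simp
      moreover have "B powr (- e) * (B * real L) powr e = real L powr e"
        using B by (simp add: powr_mult powr_minus)
      ultimately have le2: "real L powr e \<le> B powr (- e) * log 2 (real n + 1) powr e" by simp
      have "4 powr (- real L / p) * real L powr e
          \<le> ((8 * C1) powr (1 / p) * real n powr (- 1 / p)) * (B powr (- e) * log 2 (real n + 1) powr e)"
        by (intro mult_mono n_p n le2) auto
      then have "C4 * (4 powr (- real L / p) * real L powr e)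
          \<le> C4 * (((8 * C1) powr (1 / p) * real n powr (- 1 / p)) * (B powr (- e) * log 2 (real n + 1) powr e))"
        using C4 by (rule mult_left_mono)
      then show "C4 * (4 powr (- real L / p) * real L powr e)
          \<le> C4 * (8 * C1) powr (1 / p) * B powr (- e) * (real n powr (- 1 / p) * log 2 (real n + 1) powr e)"
        by (simp only: mult_ac)
    next
      fix n :: nat assume "1 \<le> n"
      then have "real n \<noteq> 0" "0 < log 2 (real n + 1)" by simp_all
      then have "0 < real n powr (- 1 / p)" "0 < log 2 (real n + 1) powr e"
        by (simp_all only: powr_gt_zero less_imp_neq[symmetric] not_False_eq_True)
      then show "0 < real n powr (- 1 / p) * log 2 (real n + 1) powr e" by (rule mult_pos_pos)
    qed (use C2 in auto)
  qed
qed

end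

section \<open>Power and logarithmic kernels\<close>

context conjugate_exponents begin

lemma power_profile:
  assumes \<tau>: "0 < \<tau>" "\<tau> < 1 / q"
  shows "singular_profile p q (\<lambda>x. x powr (- \<tau>)) (\<lambda>\<delta>. \<delta> powr (1 - \<tau> * q) / (1 - \<tau> * q)) 0"
proof
  have \<tau>q: "\<tau> * q < 1" using \<tau> q_pos by (simp add: field_simps)
  fix \<delta> :: real assume "0 \<le> \<delta>"
  then show "((\<lambda>x. (x powr (- \<tau>)) powr q) has_integral \<delta> powr (1 - \<tau> * q) / (1 - \<tau> * q)) {0..\<delta>}"
    using has_integral_powr_from_0[of "- (\<tau> * q)" \<delta>] \<tau>q by (simp add: powr_powr)
next
  fix u v :: real assume "0 < u" "u \<le> v"
  then have "(v powr (- \<tau>)) powr q \<le> (u powr (- \<tau>)) powr q"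
    using \<tau> q_pos by (intro powr_mono2 powr_mono2') auto
  then show "(v powr (- \<tau>)) powr q - (u powr (- \<tau>)) powr q \<le> 0 * (v - u)" by simp
qed auto

text \<open>The modulus exponent is \<open>\<alpha> = 1/q - \<tau>\<close>, and \<open>\<alpha> + 1/p = 1 - \<tau>\<close>.\<close>
lemma power_kernel:
  assumes \<tau>: "0 < \<tau>" "\<tau> < 1 / q"
    and K: "K \<in> {WS_kernel (\<lambda>x. x powr (- \<tau>)), VO_kernel (\<lambda>x. x powr (- \<tau>))}"
  shows "bounded_operator_Lp_C01 p K" "operator_entropy_number p K \<preceq> (\<lambda>n. real n powr (\<tau> - 1))"
proof -
  define \<alpha> where "\<alpha> = 1 / q - \<tau>"
  define C where "C = (16 / (1 - \<tau> * q)) powr (1 / q)"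
  define \<Omega> where "\<Omega> a = C * 2 powr (- \<alpha> * real a)" for a :: nat
  have \<tau>q: "0 < 1 - \<tau> * q" using \<tau> q_pos by (simp add: field_simps)
  have \<alpha>: "0 < \<alpha>" using \<tau> by (simp add: \<alpha>_def)
  have \<alpha>q: "\<alpha> * q = 1 - \<tau> * q" using q_pos by (simp add: \<alpha>_def algebra_simps)
  have C: "0 < C" using \<tau>q by (simp add: C_def)
  interpret singular_profile p q "\<lambda>x. x powr (- \<tau>)" "\<lambda>\<delta>. \<delta> powr (1 - \<tau> * q) / (1 - \<tau> * q)" 0
    by (rule power_profile[OF \<tau>])
  have "kernel_modulus p q K \<Omega>"
  proof (rule kernel_modulusI[OF K])
    show "0 < \<Omega> a" for a using C by (simp add: \<Omega>_def)
    have "(\<lambda>a. C * (2 powr (- \<alpha>)) ^ a) \<longlonglongrightarrow> C * 0"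
      using \<alpha> by (intro tendsto_intros LIMSEQ_power_zero) (simp add: powr_less_one)
    moreover have "C * (2 powr (- \<alpha>)) ^ a = \<Omega> a" for a
      by (simp add: \<Omega>_def powr_powr flip: powr_realpow)
    ultimately show "\<Omega> \<longlonglongrightarrow> 0" by simp
    fix a :: nat
    have "\<Omega> a powr q = C powr q * (2 powr (- \<alpha> * real a)) powr q"
      using C by (simp add: \<Omega>_def powr_mult)
    also have "C powr q = 16 / (1 - \<tau> * q)" using \<tau>q q_pos by (simp add: C_def powr_powr)
    also have "(2 powr (- \<alpha> * real a)) powr q = 2 powr (- (real a * (1 - \<tau> * q)))"
      unfolding powr_powr \<alpha>q[symmetric] by (simp add: mult_ac)
    also have "\<dots> = (1 / 2 ^ a) powr (1 - \<tau> * q)"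
      by (simp add: powr_divide powr_powr powr_minus_divide flip: powr_realpow)
    finally show "16 * ((1 / 2 ^ a) powr (1 - \<tau> * q) / (1 - \<tau> * q) + 0 * (1 / 2 ^ a)) \<le> \<Omega> a powr q"
      by simp
  qed
  then interpret kernel_modulus p q K \<Omega> .
  show "bounded_operator_Lp_C01 p K" by (rule bounded_operator)
  have "operator_entropy_number p K \<preceq> (\<lambda>n. real n powr (- (\<alpha> + 1 / p)))"
    by (rule entropy_polynomial_modulus[OF \<alpha> C]) (simp add: \<Omega>_def)
  moreover have "- (\<alpha> + 1 / p) = \<tau> - 1" using conjugate by (simp add: \<alpha>_def)
  ultimately show "operator_entropy_number p K \<preceq> (\<lambda>n. real n powr (\<tau> - 1))" by simp
qed

end

text \<open>The primitive of \<open>x\<^sup>-\<^sup>1 (c - ln x)\<^sup>-\<^sup>b\<close> that vanishes at the origin. There the formula itself would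
  give a wrong value, as \<open>ln 0 = 0\<close>.\<close>
definition log_primitive :: "real \<Rightarrow> real \<Rightarrow> real \<Rightarrow> real"
  where "log_primitive c b x = (if x \<le> 0 then 0 else (c - ln x) powr (1 - b) / (b - 1))"

lemma log_primitive_integral:
  assumes c: "0 < c" and b: "1 < b" and \<delta>: "0 \<le> \<delta>" "\<delta> \<le> 1"
  shows "((\<lambda>x. x powr (- 1) * (c - ln x) powr (- b)) has_integral log_primitive c b \<delta>) {0..\<delta>}"
proof -
  let ?F = "log_primitive c b" and ?G = "\<lambda>x. (c - ln x) powr (1 - b) / (b - 1)"
  have pos: "0 < c - ln x" if "0 < x" "x \<le> 1" for x :: real
    using that c ln_le_zero_iff[OF that(1)] by linarith
  have deriv: "(?G has_real_derivative x powr (- 1) * (c - ln x) powr (- b)) (at x)" if "0 < x" "x \<le> 1" for x :: real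
  proof -
    have "(?G has_real_derivative ((1 - b) * (c - ln x) powr (1 - b - 1) * (- (1 / x))) / (b - 1)) (at x)"
      using that pos[OF that] b by (auto intro!: derivative_eq_intros)
    moreover have "((1 - b) * (c - ln x) powr (1 - b - 1) * (- (1 / x))) / (b - 1) = x powr (- 1) * (c - ln x) powr (- b)"
    proof -
      define P where "P = (c - ln x) powr (- b)"
      have "(1 - b) * P * (- (1 / x)) = (b - 1) * (P / x)" by (simp add: algebra_simps diff_divide_distrib)
      then have "(1 - b) * P * (- (1 / x)) / (b - 1) = P / x" using b by simp
      then show ?thesis using that by (simp add: P_def powr_minus_divide)
    qed
    ultimately show ?thesis by simp
  qed
  have F_deriv: "(?F has_real_derivative x powr (- 1) * (c - ln x) powr (- b)) (at x)" if "0 < x" "x \<le> 1" for x :: real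
  proof (rule has_field_derivative_transform_within_open[OF deriv[OF that]])
    show "open {0 :: real<..}" "x \<in> {0<..}" using that by auto
  qed (auto simp: log_primitive_def)
  have "LIM x at_right 0. c + - ln x :> at_top"
    by (intro filterlim_tendsto_add_at_top[OF tendsto_const]
        filterlim_compose[OF filterlim_uminus_at_top_at_bot ln_at_0])
  then have "((\<lambda>x. (c + - ln x) powr (1 - b)) \<longlongrightarrow> 0) (at_right 0)"
    using b by (intro tendsto_neg_powr) auto
  then have "(?G \<longlongrightarrow> 0 / (b - 1)) (at_right 0)" using b by (intro tendsto_divide) auto
  moreover have "\<forall>\<^sub>F x in at_right 0. ?G x = ?F x"
    by (auto simp: eventually_at_filter log_primitive_def)
  ultimately have lim0: "(?F \<longlongrightarrow> 0) (at_right 0)" by (simp add: tendsto_cong)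
  have "continuous_on {0..\<delta>} ?F"
  proof (rule continuous_on_eq_continuous_within[THEN iffD2], rule ballI)
    fix x assume x: "x \<in> {0..\<delta>}"
    show "continuous (at x within {0..\<delta>}) ?F"
    proof (cases "x = 0")
      case True
      have "at 0 within {0..\<delta>} \<le> at_right 0"
        unfolding at_within_def by (intro inf_mono) auto
      then have "(?F \<longlongrightarrow> 0) (at 0 within {0..\<delta>})" using lim0 by (rule tendsto_mono)
      then show ?thesis by (simp add: True continuous_within log_primitive_def)
    next
      case False
      then have "isCont ?F x" using x \<delta> by (intro DERIV_isCont[OF F_deriv]) auto
      then show ?thesis by (rule continuous_at_imp_continuous_at_within)
    qed
  qed
  then have "((\<lambda>x. x powr (- 1) * (c - ln x) powr (- b)) has_integral ?F \<delta> - ?F 0) {0..\<delta>}"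
    using \<delta> F_deriv
    by (intro fundamental_theorem_of_calculus_interior)
      (auto simp flip: has_real_derivative_iff_has_vector_derivative)
  then show ?thesis by (simp add: log_primitive_def)
qed

text \<open>The derivative is \<open>x\<^sup>-\<^sup>2 y\<^sup>-\<^sup>b\<^sup>-\<^sup>1 (b - y)\<close> with \<open>y = c - ln x\<close>. It is positive only where
  \<open>y < b\<close>, that is for \<open>x > exp (c - b)\<close>, away from the singularity, where it is bounded.\<close>
lemma log_density_increase:
  fixes c b u v :: real
  assumes c: "0 < c" and b: "1 < b" and u: "0 < u" "u \<le> v" "v \<le> 1"
  shows "v powr (- 1) * (c - ln v) powr (- b) - u powr (- 1) * (c - ln u) powr (- b)
      \<le> (exp (2 * (b - c)) * c powr (- b - 1) * b) * (v - u)"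
proof -
  let ?D = "\<lambda>x. (1 / x) * (c - ln x) powr (- b)"
  let ?D' = "\<lambda>x. (1 / x)\<^sup>2 * (c - ln x) powr (- b - 1) * (b - (c - ln x))"
  define M where "M = exp (2 * (b - c)) * c powr (- b - 1) * b"
  have M: "0 \<le> M" using b by (simp add: M_def)
  have ge_c: "c \<le> c - ln x" if "0 < x" "x \<le> 1" for x :: real using that ln_le_zero_iff[OF that(1)] by linarith
  have deriv: "(?D has_real_derivative ?D' x) (at x)" if "0 < x" "x \<le> 1" for x :: real
  proof -
    have pos: "0 < c - ln x" using ge_c[OF that] c by linarith
    have "(?D has_real_derivative (- (1 / x\<^sup>2)) * (c - ln x) powr (- b)
        + (1 / x) * (- b * (c - ln x) powr (- b - 1) * (- (1 / x)))) (at x)"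
      using that pos by (auto intro!: derivative_eq_intros simp: power2_eq_square diff_divide_distrib)
    moreover have "(c - ln x) powr (- b) = (c - ln x) powr (- b - 1) * (c - ln x)"
      using pos by (simp add: powr_diff)
    ultimately show ?thesis
      using that by (simp add: power2_eq_square field_simps)
  qed
  have le_M: "?D' x \<le> M" if "0 < x" "x \<le> 1" for x :: real
  proof (cases "b \<le> c - ln x")
    case True
    then have "?D' x \<le> 0" by (intro mult_nonneg_nonpos) auto
    then show ?thesis using M by linarith
  next
    case False
    then have "c - b \<le> ln x" by simp
    then have "exp (c - b) \<le> x" using that by (simp add: ln_ge_iff)
    then have "1 / x \<le> 1 / exp (c - b)" using that by (intro divide_left_mono) auto
    also have "\<dots> = exp (b - c)" by (simp add: exp_diff)
    finally have "(1 / x)\<^sup>2 \<le> (exp (b - c))\<^sup>2" using that by (intro power_mono) auto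
    also have "\<dots> = exp (2 * (b - c))" by (rule exp_double[symmetric])
    finally have 1: "(1 / x)\<^sup>2 \<le> exp (2 * (b - c))" .
    have 2: "(c - ln x) powr (- b - 1) \<le> c powr (- b - 1)"
      using ge_c[OF that] c b by (intro powr_mono2') auto
    have 3: "b - (c - ln x) \<le> b" using ge_c[OF that] c by linarith
    show ?thesis unfolding M_def
      using 1 2 3 False by (intro mult_mono mult_nonneg_nonneg) auto
  qed
  have "?D v - ?D u \<le> M * (v - u)"
  proof (cases "u = v")
    case False
    then have "u < v" using u by simp
    then have "\<exists>z>u. z < v \<and> ?D v - ?D u = (v - u) * ?D' z"
      by (rule MVT2) (rule deriv; use u in linarith)
    then obtain z where z: "u < z" "z < v" "?D v - ?D u = (v - u) * ?D' z" by blast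
    have "(v - u) * ?D' z \<le> (v - u) * M" using u z by (intro mult_left_mono le_M) auto
    then show ?thesis using z(3) by (simp add: mult.commute)
  qed simp
  then show ?thesis using u by (simp add: M_def powr_minus_divide)
qed

context conjugate_exponents begin

lemma log_profile_powr:
  "(x powr (- 1 / q) * (c - ln x) powr (- \<beta>)) powr q = x powr (- 1) * (c - ln x) powr (- (\<beta> * q))"
  using q_pos by (simp add: powr_mult powr_powr)

lemma log_profile:
  assumes \<beta>: "1 / q < \<beta>" and c: "0 < c"
  shows "singular_profile p q (\<lambda>x. x powr (- 1 / q) * (c - ln x) powr (- \<beta>)) (log_primitive c (\<beta> * q))
    (exp (2 * (\<beta> * q - c)) * c powr (- (\<beta> * q) - 1) * (\<beta> * q))"
proof
  have b: "1 < \<beta> * q" using \<beta> q_pos by (simp add: field_simps)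
  show "0 \<le> exp (2 * (\<beta> * q - c)) * c powr (- (\<beta> * q) - 1) * (\<beta> * q)" using b by simp
  fix \<delta> :: real assume "0 \<le> \<delta>" "\<delta> \<le> 1"
  then show "((\<lambda>x. (x powr (- 1 / q) * (c - ln x) powr (- \<beta>)) powr q) has_integral log_primitive c (\<beta> * q) \<delta>) {0..\<delta>}"
    unfolding log_profile_powr by (rule log_primitive_integral[OF c b])
next
  have b: "1 < \<beta> * q" using \<beta> q_pos by (simp add: field_simps)
  fix u v :: real assume uv: "0 < u" "u \<le> v" "v \<le> 1"
  show "(v powr (- 1 / q) * (c - ln v) powr (- \<beta>)) powr q - (u powr (- 1 / q) * (c - ln u) powr (- \<beta>)) powr q
      \<le> exp (2 * (\<beta> * q - c)) * c powr (- (\<beta> * q) - 1) * (\<beta> * q) * (v - u)"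
    unfolding log_profile_powr by (rule log_density_increase[OF c b uv])
qed auto

text \<open>The modulus exponent is \<open>\<gamma> = \<beta> - 1/q\<close>, and \<open>1/p - \<gamma> = 1 - \<beta>\<close>, so the critical exponent
  \<open>\<gamma> = 1/p\<close> is \<open>\<beta> = 1\<close>.\<close>
lemma log_kernel:
  assumes \<beta>: "1 / q < \<beta>" and c: "0 < c"
    and K: "K \<in> {WS_kernel (\<lambda>x. x powr (- 1 / q) * (c - ln x) powr (- \<beta>)),
                 VO_kernel (\<lambda>x. x powr (- 1 / q) * (c - ln x) powr (- \<beta>))}"
  shows "bounded_operator_Lp_C01 p K"
    and "\<beta> < 1 \<Longrightarrow> operator_entropy_number p K \<preceq> (\<lambda>n. real n powr (1 / q - \<beta>))"
    and "1 < \<beta> \<Longrightarrow> operator_entropy_number p K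
           \<preceq> (\<lambda>n. real n powr (- 1 / p) * log 2 (real n + 1) powr (1 - \<beta>))"
    and "\<beta> = 1 \<Longrightarrow> operator_entropy_number p K \<preceq> (\<lambda>n. real n powr (- 1 / p) * log 2 (real n + 1))"
proof -
  define \<gamma> where "\<gamma> = \<beta> - 1 / q"
  define b where "b = \<beta> * q"
  define M where "M = exp (2 * (b - c)) * c powr (- b - 1) * b"
  have b: "1 < b" using \<beta> q_pos by (simp add: b_def field_simps)
  have M: "0 \<le> M" using b by (simp add: M_def)
  have \<gamma>: "0 < \<gamma>" using \<beta> by (simp add: \<gamma>_def)
  have \<gamma>q: "\<gamma> * q = b - 1" using q_pos by (simp add: \<gamma>_def b_def algebra_simps)
  \<comment> \<open>With these constants \<open>c1 (1 + a) \<le> c + a ln 2\<close>, which bounds the integral of \<open>k\<^sup>q\<close> near the origin,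
     and \<open>(c2 (1 + a))\<^sup>b\<^sup>-\<^sup>1 \<le> 2\<^sup>a\<close>, which absorbs the error term of order \<open>2\<^sup>-\<^sup>a\<close>.\<close>
  define c1 where "c1 = min c (ln 2)"
  define c2 where "c2 = min 1 (ln 2 / (b - 1))"
  have c1: "0 < c1" using c by (simp add: c1_def)
  have c2: "0 < c2" using b by (simp add: c2_def)
  define Q where "Q = 16 * (c1 powr (1 - b) / (b - 1) + M * c2 powr (1 - b))"
  have Q: "0 < Q" using c1 b M by (simp add: Q_def add_pos_nonneg)
  define C where "C = Q powr (1 / q)"
  have C: "0 < C" using Q by (simp add: C_def)
  define \<Omega> where "\<Omega> a = C * (1 + real a) powr (- \<gamma>)" for a :: nat
  interpret singular_profile p q "\<lambda>x. x powr (- 1 / q) * (c - ln x) powr (- \<beta>)" "log_primitive c b" M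
    using log_profile[OF \<beta> c] by (simp only: M_def b_def)
  have "kernel_modulus p q K \<Omega>"
  proof (rule kernel_modulusI[OF K])
    show "0 < \<Omega> a" for a using C by (simp add: \<Omega>_def)
    have "LIM a sequentially. 1 + real a :> at_top"
      by (intro filterlim_tendsto_add_at_top[OF tendsto_const] filterlim_real_sequentially)
    then have "(\<lambda>a. (1 + real a) powr (- \<gamma>)) \<longlonglongrightarrow> 0" using \<gamma> by (intro tendsto_neg_powr) auto
    then have "(\<lambda>a. C * (1 + real a) powr (- \<gamma>)) \<longlonglongrightarrow> C * 0" by (intro tendsto_mult tendsto_const)
    then show "\<Omega> \<longlonglongrightarrow> 0" by (simp add: \<Omega>_def[abs_def])
    fix a :: nat
    define N where "N = (1 + real a) powr (1 - b)"
    have "\<Omega> a powr q = C powr q * ((1 + real a) powr (- \<gamma>)) powr q"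
      using C by (simp add: \<Omega>_def powr_mult)
    also have "C powr q = Q" using Q q_pos by (simp add: C_def powr_powr)
    also have "((1 + real a) powr (- \<gamma>)) powr q = N" using \<gamma>q by (simp add: N_def powr_powr)
    finally have \<Omega>q: "\<Omega> a powr q = Q * N" .
    have ln2a: "ln (1 / 2 ^ a) = - (real a * ln 2)" by (simp add: ln_div ln_realpow)
    have "c1 * (1 + real a) \<le> c + real a * ln 2"
    proof -
      have "c1 * real a \<le> ln 2 * real a" by (intro mult_right_mono) (auto simp: c1_def)
      moreover have "c1 \<le> c" by (simp add: c1_def)
      ultimately show ?thesis by (simp add: algebra_simps)
    qed
    then have "(c + real a * ln 2) powr (1 - b) \<le> (c1 * (1 + real a)) powr (1 - b)"
      using c1 b by (intro powr_mono2') auto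
    also have "\<dots> = c1 powr (1 - b) * N" using c1 by (simp add: N_def powr_mult)
    finally have "(c + real a * ln 2) powr (1 - b) / (b - 1) \<le> c1 powr (1 - b) * N / (b - 1)"
      using b by (intro divide_right_mono) auto
    then have 1: "log_primitive c b (1 / 2 ^ a) \<le> c1 powr (1 - b) / (b - 1) * N"
    proof -
      have "\<not> 1 / 2 ^ a \<le> (0 :: real)" by (simp add: not_le)
      then show ?thesis
        using \<open>(c + real a * ln 2) powr (1 - b) / (b - 1) \<le> c1 powr (1 - b) * N / (b - 1)\<close>
        unfolding log_primitive_def ln2a by (simp only: if_False) simp
    qed
    have 2: "1 / 2 ^ a \<le> c2 powr (1 - b) * N"
    proof -
      define t where "t = ln 2 / (b - 1)"
      have "c2 * (1 + real a) \<le> 1 + real a * t"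
      proof -
        have "c2 * real a \<le> t * real a" by (intro mult_right_mono) (auto simp: c2_def t_def)
        moreover have "c2 \<le> 1" by (simp add: c2_def)
        ultimately show ?thesis by (simp add: algebra_simps)
      qed
      also have "\<dots> \<le> exp (real a * t)" by (rule exp_ge_add_one_self)
      finally have "(exp (real a * t)) powr (1 - b) \<le> (c2 * (1 + real a)) powr (1 - b)"
        using c2 b by (intro powr_mono2') auto
      also have "\<dots> = c2 powr (1 - b) * N" using c2 by (simp add: N_def powr_mult)
      also have "(exp (real a * t)) powr (1 - b) = exp (- (real a * ln 2))"
        using b by (simp add: powr_def t_def field_simps)
      also have "\<dots> = 1 / 2 ^ a"
        by (simp add: exp_minus exp_of_nat_mult divide_inverse)
      finally show ?thesis .
    qed
    have 3: "M * (1 / 2 ^ a) \<le> M * (c2 powr (1 - b) * N)" using M by (intro mult_left_mono 2)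
    show "16 * (log_primitive c b (1 / 2 ^ a) + M * (1 / 2 ^ a)) \<le> \<Omega> a powr q"
    proof -
      have "16 * (log_primitive c b (1 / 2 ^ a) + M * (1 / 2 ^ a))
          \<le> 16 * (c1 powr (1 - b) / (b - 1) * N + M * (c2 powr (1 - b) * N))"
        by (rule mult_left_mono[OF add_mono[OF 1 3]]) simp
      also have "\<dots> = Q * N" by (simp add: Q_def algebra_simps)
      finally show ?thesis unfolding \<Omega>q .
    qed
  qed
  then interpret kernel_modulus p q K \<Omega> .
  have \<Omega>_le: "\<Omega> a \<le> C * (1 + real a) powr (- \<gamma>)" for a by (simp add: \<Omega>_def)
  note rates = entropy_logarithmic_modulus[OF \<gamma> C \<Omega>_le]
  show "bounded_operator_Lp_C01 p K" by (rule bounded_operator)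
  have e: "1 / p - \<gamma> = 1 - \<beta>" using conjugate by (simp add: \<gamma>_def)
  show "operator_entropy_number p K \<preceq> (\<lambda>n. real n powr (1 / q - \<beta>))" if "\<beta> < 1"
    using rates(1) e that by (simp add: \<gamma>_def)
  show "operator_entropy_number p K \<preceq> (\<lambda>n. real n powr (- 1 / p) * log 2 (real n + 1))" if "\<beta> = 1"
    using rates(2) e that by simp
  show "operator_entropy_number p K \<preceq> (\<lambda>n. real n powr (- 1 / p) * log 2 (real n + 1) powr (1 - \<beta>))"
    if "1 < \<beta>"
    using rates(3) that unfolding e by (metis e diff_less_0_iff_less)
qed

end

theorem theorem5p8:
  fixes p p' :: real
  assumes "2 \<le> p" and "1 / p + 1 / p' = 1"
  shows
    "(\<forall>\<tau>. 0 < \<tau> \<and> \<tau> < 1 / p' \<longrightarrow>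
        (let k = (\<lambda>x. x powr (- \<tau>)) in
          \<forall>K\<in>{WS_kernel k, VO_kernel k}.
            bounded_operator_Lp_C01 p K \<and>
            operator_entropy_number p K \<preceq> (\<lambda>n. real n powr (\<tau> - 1)))) \<and>
     (\<forall>\<beta> c\<^sub>0. 1 / p' < \<beta> \<and> 0 < c\<^sub>0 \<longrightarrow>
        (let k = (\<lambda>x. x powr (- 1 / p') * (c\<^sub>0 - ln x) powr (- \<beta>)) in
          \<forall>K\<in>{WS_kernel k, VO_kernel k}.
            bounded_operator_Lp_C01 p K \<and>
            (\<beta> < 1 \<longrightarrow>
              operator_entropy_number p K \<preceq> (\<lambda>n. real n powr (1 / p' - \<beta>))) \<and>
            (1 < \<beta> \<longrightarrow>
              operator_entropy_number p K
                \<preceq> (\<lambda>n. real n powr (- 1 / p) * log 2 (real n + 1) powr (1 - \<beta>))) \<and>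
            (\<beta> = 1 \<longrightarrow>
              operator_entropy_number p K
                \<preceq> (\<lambda>n. real n powr (- 1 / p) * log 2 (real n + 1)))))"
proof -
  interpret conjugate_exponents p p' using assms by unfold_locales
  show ?thesis
    unfolding Let_def
  proof (intro conjI allI impI ballI)
    fix \<tau> K
    assume "0 < \<tau> \<and> \<tau> < 1 / p'" "K \<in> {WS_kernel (\<lambda>x. x powr (- \<tau>)), VO_kernel (\<lambda>x. x powr (- \<tau>))}"
    then show "bounded_operator_Lp_C01 p K" "operator_entropy_number p K \<preceq> (\<lambda>n. real n powr (\<tau> - 1))"
      using power_kernel by auto
  next
    fix \<beta> c\<^sub>0 K
    assume \<beta>: "1 / p' < \<beta> \<and> 0 < c\<^sub>0"
      and K: "K \<in> {WS_kernel (\<lambda>x. x powr (- 1 / p') * (c\<^sub>0 - ln x) powr (- \<beta>)),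
                    VO_kernel (\<lambda>x. x powr (- 1 / p') * (c\<^sub>0 - ln x) powr (- \<beta>))}"
    note bounds = log_kernel[OF conjunct1[OF \<beta>] conjunct2[OF \<beta>] K]
    show "bounded_operator_Lp_C01 p K" by (rule bounds(1))
    show "operator_entropy_number p K \<preceq> (\<lambda>n. real n powr (1 / p' - \<beta>))" if "\<beta> < 1"
      using that by (rule bounds(2))
    show "operator_entropy_number p K \<preceq> (\<lambda>n. real n powr (- 1 / p) * log 2 (real n + 1) powr (1 - \<beta>))"
      if "1 < \<beta>" using that by (rule bounds(3))
    show "operator_entropy_number p K \<preceq> (\<lambda>n. real n powr (- 1 / p) * log 2 (real n + 1))"
      if "\<beta> = 1" using that by (rule bounds(4))
  qed
qed

end
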